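(* Let $\lambda_0<\lambda_1$ and $\lambda_2$ be three distinct real numbers and let $a<b$. For each $n\ge2$ let $\Lambda_n=(\lambda_0,\lambda_1,\lambda_2,\lambda_3^{(n)},\dots,\lambda_n^{(n)})\in\mathbb{C}^{n+1}$, where the entries $\lambda_j^{(n)}$, $j\ge3$, may depend on $n$. Suppose each $E_{\Lambda_n}$ is closed under complex conjugation and there is $M>0$ with $|\mathrm{Im}\,\lambda_j^{(n)}|\le M$ for all $n$ and $j$, and that $b-a<\pi/M$. For $k=0,\dots,n-1$ let $$b(n,k):=\lim_{x\to b}\frac{p_{(\lambda_0,\lambda_1,\lambda_3^{(n)},\dots,\lambda_n^{(n)}),k}(x)}{p_{(\lambda_1,\lambda_2,\lambda_3^{(n)},\dots,\lambda_n^{(n)}),k}(x)}$$ (a positive real number), and let $t_k=t_k^{(n)}$, $k=0,\dots,n$, be the nodes of the Bernstein operator $B_{\Lambda_n}$ associated with $\Lambda_n$ and $[a,b]$ as described below. Assume that $t_k^{(n)}-t_{k-1}^{(n)}\to0$ as $n\to\infty$ uniformly in $k$, and that $$\lim_{n\to\infty}\frac{\log b(n,k)}{t_k^{(n)}-t_{k+1}^{(n)}}=\lambda_2-\lambda_0$$ uniformly in $k$. Then for every $f\in C([a,b],\mathbb{C})$, $B_{\Lambda_n}f\to f$ uniformly on $[a,b]$ as $n\to\infty$.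
   Context: For $\mu=(\mu_0,\dots,\mu_m)\in\mathbb{C}^{m+1}$, $E_\mu$ denotes the space of all $f\in C^\infty(\mathbb{R},\mathbb{C})$ with $(\frac{d}{dx}-\mu_0)\cdots(\frac{d}{dx}-\mu_m)f=0$ (dimension $m+1$, independent of the ordering); it is closed under complex conjugation if $\overline f\in E_\mu$ whenever $f\in E_\mu$. A zero of order (exactly) $k$ at $a$ means $f(a)=\dots=f^{(k-1)}(a)=0$, $f^{(k)}(a)\neq0$. Under the hypotheses, all spaces involved are extended Chebyshev systems over $[a,b]$ (each nonzero element has at most $m$ zeros in $[a,b]$ with multiplicity), so each has a Bernstein basis $p_{\mu,k}$, $k=0,\dots,m$, w.r.t. $a,b$: the unique family in $E_\mu$ with a zero of order exactly $k$ at $a$, exactly $m-k$ at $b$, and $p_{\mu,k}^{(k)}(a)=1$. The Bernstein operator of $\Lambda=(\lambda_0,\dots,\lambda_n)$ (with $\lambda_0<\lambda_1$ real) is $B_\Lambda f=\sum_{k=0}^n\alpha_kf(t_k)p_{\Lambda,k}$, where $t_0=a$, $e^{(\lambda_0-\lambda_1)(t_k-t_{k-1})}=\lim_{x\to b}p_{(\lambda_0,\lambda_2,\dots,\lambda_n),k-1}(x)/p_{(\lambda_1,\dots,\lambda_n),k-1}(x)$ for $k=1,\dots,n$, $\alpha_0=1$ and $\alpha_k=e^{-\lambda_0(t_k-a)}(-1)^k\prod_{l=0}^{k-1}\lim_{x\to b}\frac{d}{dx}p_{\Lambda,l}(x)/p_{(\lambda_1,\dots,\lambda_n),l}(x)$;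 these satisfy $a=t_0<\dots<t_n=b$, $\alpha_k>0$, and $B_\Lambda$ fixes $e^{\lambda_0x}$ and $e^{\lambda_1x}$. *)

theory Defs
  imports "HOL-Analysis.Analysis"
begin

primrec hdiff :: "nat \<Rightarrow> (real \<Rightarrow> complex) \<Rightarrow> real \<Rightarrow> complex" where
  "hdiff 0 f = f"
| "hdiff (Suc k) f = (\<lambda>x. vector_derivative (hdiff k f) (at x))"

definition smooth :: "(real \<Rightarrow> complex) \<Rightarrow> bool" where
  "smooth f \<longleftrightarrow> (\<forall>k x. (hdiff k f has_vector_derivative hdiff (Suc k) f x) (at x))"

primrec diffop :: "complex list \<Rightarrow> (real \<Rightarrow> complex) \<Rightarrow> real \<Rightarrow> complex" where
  "diffop [] f = f"
| "diffop (c # cs) f = (\<lambda>x. vector_derivative (diffop cs f) (at x) - c * diffop cs f x)"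

definition Espace :: "complex list \<Rightarrow> (real \<Rightarrow> complex) set" where
  "Espace mu = {f. smooth f \<and> (\<forall>x. diffop mu f x = 0)}"

definition zero_order :: "(real \<Rightarrow> complex) \<Rightarrow> real \<Rightarrow> nat \<Rightarrow> bool" where
  "zero_order f a k \<longleftrightarrow> (\<forall>i<k. hdiff i f a = 0) \<and> hdiff k f a \<noteq> 0"

definition bbasis :: "complex list \<Rightarrow> real \<Rightarrow> real \<Rightarrow> nat \<Rightarrow> real \<Rightarrow> complex" where
  "bbasis mu a b k = (THE p. p \<in> Espace mu \<and> zero_order p a k
      \<and> zero_order p b (length mu - 1 - k) \<and> hdiff k p a = 1)"

fun bnode :: "complex list \<Rightarrow> real \<Rightarrow> real \<Rightarrow> nat \<Rightarrow> real" where
  "bnode Lam a b 0 = a"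
| "bnode Lam a b (Suc k) = bnode Lam a b k +
     (THE d::real. exp (of_real d * (Lam ! 0 - Lam ! 1)) =
        Lim (at_left b) (\<lambda>x. bbasis (Lam ! 0 # drop 2 Lam) a b k x / bbasis (tl Lam) a b k x))"

definition balpha :: "complex list \<Rightarrow> real \<Rightarrow> real \<Rightarrow> nat \<Rightarrow> complex" where
  "balpha Lam a b k = exp (- (Lam ! 0) * of_real (bnode Lam a b k - a)) * (-1) ^ k *
     (\<Prod>l<k. Lim (at_left b)
        (\<lambda>x. vector_derivative (bbasis Lam a b l) (at x) / bbasis (tl Lam) a b l x))"

definition bop :: "complex list \<Rightarrow> real \<Rightarrow> real \<Rightarrow> (real \<Rightarrow> complex) \<Rightarrow> real \<Rightarrow> complex" where
  "bop Lam a b f = (\<lambda>x. \<Sum>k\<le>length Lam - 1.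
      balpha Lam a b k * f (bnode Lam a b k) * bbasis Lam a b k x)"

end

theory Submission
  imports Defs
begin

text \<open>
  Write \<open>p\<^sub>k\<close> for the Bernstein basis of \<open>E\<^sub>\<Lambda>\<close> and, for a real entry \<open>c\<close> of
  \<open>\<Lambda>\<close>, write \<open>q\<^sub>k\<close> for the Bernstein basis of \<open>E\<^sub>\<Lambda>\<^sub>'\<close>, where \<open>\<Lambda>'\<close> is
  \<open>\<Lambda>\<close> with one \<open>c\<close> removed. Counting zeros at the endpoints gives
  \<open>(D - c) p\<^sub>k = q\<^sub>k\<^sub>-\<^sub>1 + d\<^sub>k q\<^sub>k\<close> with \<open>d\<^sub>k\<close> the limit of
  \<open>p\<^sub>k' / q\<^sub>k\<close> at \<open>b\<close>, so the coefficients of \<open>exp (c (x - a))\<close> in the basis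
  \<open>p\<^sub>k\<close> are the products of the \<open>- d\<^sub>l\<close>, \<open>l < k\<close>. The choices \<open>c = \<lambda>\<^sub>0, \<lambda>\<^sub>1\<close>
  show that the operator fixes these two exponentials. For \<open>c = \<lambda>\<^sub>2\<close> the coefficients differ from
  those of \<open>\<lambda>\<^sub>0\<close> by the factors \<open>1 / b(n, l)\<close>, and the hypothesis on \<open>log b(n, k)\<close> makes
  them asymptotic to the values which the operator uses; hence the images of \<open>exp (\<lambda>\<^sub>2 x)\<close>
  converge. The operators are positive, so Korovkin's theorem for the three exponentials applies.
\<close>

section \<open>Spaces of exponential polynomials\<close>

text \<open>Everything rests on the zero bound \<open>Espace_zero_count\<close>: without it,
  \<open>bbasis\<close> is an opaque definite description. Rolle's theorem deals with real factors,
  so non-real exponents have to be treated in conjugate pairs; for this, closure of the space under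
  conjugation is translated into invariance of the multiset of exponents. The count gives
  multiplicity to the endpoints and treats interior zeros as distinct points, which is how the basis
  functions use it. All limits at \<open>b\<close> become quotients of real numbers
  \<open>bend\<close>, the leading derivatives of basis functions at \<open>b\<close>. Their signs
  alternate, and this is the source of all positivity. For \<lambda>2 the hypothesis controls each
  log b(n,l) up to \<epsilon> times the gap between two nodes. The gaps add up to at most b - a, so
  the accumulated factor lies between exp(-\<epsilon>(b - a)) and exp(\<epsilon>(b - a)) whatever n
  is. The exact expansion of the exponential of \<lambda>2 has nonnegative terms with known sum, and
  a relative error on its terms is therefore uniform in x.\<close>

lemma hdiff_jet:
  assumes "\<And>k x. (u k has_vector_derivative u (Suc k) x) (at x)"
  shows "hdiff k (u 0) = u k"
proof (induction k)
  case (Suc k)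
  then show ?case
    using assms by (auto intro!: ext vector_derivative_at)
qed simp

text \<open>The closure properties of \<open>smooth\<close> come from here: one writes down a whole
  candidate sequence \<open>u\<close> of derivatives and checks a single differentiation rule for
  it.\<close>

lemma smooth_jet:
  assumes "\<And>k x. (u k has_vector_derivative u (Suc k) x) (at x)"
  shows "smooth (u 0)"
  unfolding smooth_def by (metis assms hdiff_jet)

lemma smooth_hdiffD:
  "smooth f \<Longrightarrow> (hdiff k f has_vector_derivative hdiff (Suc k) f x) (at x)"
  by (simp add: smooth_def del: hdiff.simps)

lemma smooth_vector_derivative:
  "smooth f \<Longrightarrow> (f has_vector_derivative hdiff (Suc 0) f x) (at x)"
  using smooth_hdiffD[of f 0 x] by simp

lemma
  assumes "smooth f" "smooth g"
  shows smooth_lincomb: "smooth (\<lambda>x. A * f x + B * g x)"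
    and hdiff_lincomb: "hdiff k (\<lambda>x. A * f x + B * g x) = (\<lambda>x. A * hdiff k f x + B * hdiff k g x)"
proof -
  define u where "u = (\<lambda>k x. A * hdiff k f x + B * hdiff k g x)"
  have u: "(u k has_vector_derivative u (Suc k) x) (at x)" for k x
    unfolding u_def
    by (intro has_vector_derivative_add has_vector_derivative_mult_right smooth_hdiffD assms)
  have u0: "u 0 = (\<lambda>x. A * f x + B * g x)"
    by (simp add: u_def)
  show "smooth (\<lambda>x. A * f x + B * g x)"
    using smooth_jet[of u] u u0 by simp
  show "hdiff k (\<lambda>x. A * f x + B * g x) = (\<lambda>x. A * hdiff k f x + B * hdiff k g x)"
    using hdiff_jet[of u k] u u0 by (simp add: u_def)
qed

lemma
  assumes "smooth f"
  shows smooth_cnj: "smooth (\<lambda>x. cnj (f x))"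
    and hdiff_cnj: "hdiff k (\<lambda>x. cnj (f x)) = (\<lambda>x. cnj (hdiff k f x))"
proof -
  define u where "u = (\<lambda>k x. cnj (hdiff k f x))"
  have u: "(u k has_vector_derivative u (Suc k) x) (at x)" for k x
    unfolding u_def by (intro has_vector_derivative_cnj smooth_hdiffD assms)
  have u0: "u 0 = (\<lambda>x. cnj (f x))"
    by (simp add: u_def)
  show "smooth (\<lambda>x. cnj (f x))"
    using smooth_jet[of u] u u0 by simp
  show "hdiff k (\<lambda>x. cnj (f x)) = (\<lambda>x. cnj (hdiff k f x))"
    using hdiff_jet[of u k] u u0 by (simp add: u_def)
qed

lemma
  shows smooth_exp: "smooth (\<lambda>x. exp (c * of_real (x - a)))"
    and hdiff_exp: "hdiff k (\<lambda>x. exp (c * of_real (x - a))) = (\<lambda>x. c ^ k * exp (c * of_real (x - a)))"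
proof -
  define u where "u = (\<lambda>k x. c ^ k * exp (c * of_real (x - a)))"
  have u: "(u k has_vector_derivative u (Suc k) x) (at x)" for k x
  proof -
    have "((\<lambda>z. c ^ k * exp (c * (z - of_real a))) has_field_derivative
            c ^ Suc k * exp (c * (of_real x - of_real a))) (at (of_real x))"
      by (auto intro!: derivative_eq_intros)
    from has_vector_derivative_real_field[OF this] show ?thesis
      by (simp add: u_def)
  qed
  have u0: "u 0 = (\<lambda>x. exp (c * of_real (x - a)))"
    by (simp add: u_def)
  show "smooth (\<lambda>x. exp (c * of_real (x - a)))"
    using smooth_jet[of u] u u0 by simp
  show "hdiff k (\<lambda>x. exp (c * of_real (x - a))) = (\<lambda>x. c ^ k * exp (c * of_real (x - a)))"
    using hdiff_jet[of u k] u u0 by (simp add: u_def)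
qed

lemma exp_vector_derivative:
  fixes c :: complex
  shows "((\<lambda>x. exp (c * of_real (x - a))) has_vector_derivative c * exp (c * of_real (x - a))) (at x)"
  using smooth_hdiffD[OF smooth_exp[of c a], of 0 x, unfolded hdiff_exp] by simp

lemma
  assumes "smooth f"
  shows smooth_vderiv: "smooth (\<lambda>x. vector_derivative f (at x))"
    and hdiff_vderiv: "hdiff k (\<lambda>x. vector_derivative f (at x)) = hdiff (Suc k) f"
proof -
  define u where "u = (\<lambda>k. hdiff (Suc k) f)"
  have u: "(u k has_vector_derivative u (Suc k) x) (at x)" for k x
    unfolding u_def by (intro smooth_hdiffD assms)
  have u0: "u 0 = (\<lambda>x. vector_derivative f (at x))"
    by (simp add: u_def)
  show "smooth (\<lambda>x. vector_derivative f (at x))"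
    using smooth_jet[of u] u u0 by simp
  show "hdiff k (\<lambda>x. vector_derivative f (at x)) = hdiff (Suc k) f"
    using hdiff_jet[of u k] u u0 by (simp add: u_def)
qed

lemma
  assumes "smooth f"
  shows smooth_diffop1: "smooth (diffop [c] f)"
    and hdiff_diffop1: "hdiff k (diffop [c] f) = (\<lambda>x. hdiff (Suc k) f x - c * hdiff k f x)"
  using smooth_lincomb[OF smooth_vderiv[OF assms] assms, of 1 "- c"]
    hdiff_lincomb[OF smooth_vderiv[OF assms] assms, of k 1 "- c"]
  by (simp_all add: hdiff_vderiv[OF assms] del: hdiff.simps)

text \<open>On jets, that is on the sequences of derivatives at a point, the operator becomes a
  difference operator, so identities between such operators are pure algebra.\<close>

primrec seqop :: "complex list \<Rightarrow> (nat \<Rightarrow> complex) \<Rightarrow> nat \<Rightarrow> complex" where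
  "seqop [] u = u"
| "seqop (c # cs) u = (\<lambda>i. seqop cs u (Suc i) - c * seqop cs u i)"

lemma diffop_Cons: "diffop (c # cs) f = diffop [c] (diffop cs f)"
  by simp

lemma smooth_diffop: "smooth f \<Longrightarrow> smooth (diffop cs f)"
  by (induction cs) (metis diffop.simps(1), metis diffop_Cons smooth_diffop1)

lemma hdiff_diffop:
  "smooth f \<Longrightarrow> hdiff i (diffop cs f) x = seqop cs (\<lambda>j. hdiff j f x) i"
proof (induction cs arbitrary: i)
  case (Cons c cs)
  then show ?case
    by (metis diffop_Cons hdiff_diffop1 seqop.simps(2) smooth_diffop)
qed simp

lemma diffop_eq_seqop:
  "smooth f \<Longrightarrow> diffop cs f x = seqop cs (\<lambda>j. hdiff j f x) 0"
  using hdiff_diffop[of f 0] by simp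

lemma seqop_append: "seqop (xs @ ys) u = seqop xs (seqop ys u)"
  by (induction xs) auto

lemma seqop_comm: "seqop xs (\<lambda>i. u (Suc i) - c * u i) = seqop (c # xs) u"
  by (induction xs) (auto intro!: ext simp: algebra_simps)

lemma seqop_lincomb:
  "seqop cs (\<lambda>i. A * u i + B * v i) = (\<lambda>i. A * seqop cs u i + B * seqop cs v i)"
  by (induction cs) (auto intro!: ext simp: algebra_simps)

lemma seqop_cnj: "cnj (seqop cs u i) = seqop (map cnj cs) (\<lambda>i. cnj (u i)) i"
  by (induction cs arbitrary: i) auto

text \<open>Each factor looks one entry ahead, so entry \<open>i\<close> of the result depends on
  the entries from \<open>i\<close> to \<open>i + length cs\<close>.\<close>

lemma seqop_eq_0: "(\<And>j. j \<le> i + length cs \<Longrightarrow> u j = 0) \<Longrightarrow> seqop cs u i = 0"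
  by (induction cs arbitrary: i) auto

text \<open>The jet of an exponential is an eigenvector: factor \<open>d\<close> multiplies it by
  \<open>c - d\<close>. The product is the characteristic polynomial at \<open>c\<close>.\<close>

lemma seqop_power: "seqop cs (\<lambda>i. c ^ i * z) i = (\<Prod>d\<leftarrow>cs. c - d) * c ^ i * z"
  by (induction cs arbitrary: i) (auto simp: algebra_simps)

text \<open>Factors with constant coefficients commute, so the head can be carried past any prefix
  by \<open>seqop_comm\<close>. It makes \<open>Espace\<close> independent of the ordering and lets
  any exponent be moved to the front.\<close>

lemma seqop_mset: "mset xs = mset ys \<Longrightarrow> seqop xs u = seqop ys u"
proof (induction xs arbitrary: ys)
  case (Cons c xs)
  then have "c \<in> set ys"
    by (metis list.set_intros(1) set_mset_mset)
  then obtain ys1 ys2 where ys: "ys = ys1 @ c # ys2"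
    by (meson split_list)
  with Cons.prems have "mset xs = mset (ys1 @ ys2)"
    by simp
  then have "seqop xs u = seqop (ys1 @ ys2) u"
    by (rule Cons.IH)
  then have "seqop (c # xs) u = seqop (c # ys1 @ ys2) u"
    by simp
  also have "\<dots> = seqop ys u"
    using seqop_comm[of ys1 "seqop ys2 u" c] by (simp add: ys seqop_append)
  finally show ?case .
qed simp

lemma Espace_iff:
  "f \<in> Espace mu \<longleftrightarrow> smooth f \<and> (\<forall>x. seqop mu (\<lambda>j. hdiff j f x) 0 = 0)"
  by (auto simp: Espace_def diffop_eq_seqop)

lemma Espace_smooth: "f \<in> Espace mu \<Longrightarrow> smooth f"
  by (simp add: Espace_def)

lemma Espace_mset: "mset mu = mset nu \<Longrightarrow> Espace mu = Espace nu"
  by (auto simp: Espace_iff cong: seqop_mset)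

text \<open>\<open>diffop\<close> applies the head of the list last, while here it acts before the
  others; the two agree because the factors commute on jets.\<close>

lemma Espace_Cons: "f \<in> Espace (c # cs) \<longleftrightarrow> smooth f \<and> diffop [c] f \<in> Espace cs"
proof (cases "smooth f")
  case True
  then show ?thesis
    using smooth_diffop1[OF True, of c] hdiff_diffop1[OF True, of _ c]
      seqop_comm[of cs "\<lambda>j. hdiff j f _" c]
    by (simp add: Espace_iff del: diffop.simps hdiff.simps seqop.simps)
qed (auto simp: Espace_def)

lemma Espace_subset: "Espace cs \<subseteq> Espace (c # cs)"
proof
  fix f assume "f \<in> Espace cs"
  moreover from this have "diffop cs f = (\<lambda>x. 0)"
    by (auto simp: Espace_def)
  ultimately show "f \<in> Espace (c # cs)"
    by (simp add: Espace_def)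
qed

lemma Espace_lincomb:
  "f \<in> Espace mu \<Longrightarrow> g \<in> Espace mu \<Longrightarrow> (\<lambda>x. A * f x + B * g x) \<in> Espace mu"
  by (auto simp: Espace_iff smooth_lincomb hdiff_lincomb seqop_lincomb)

lemma Espace_zero: "(\<lambda>x. 0) \<in> Espace mu"
proof -
  have "smooth (\<lambda>x. 0)" and "hdiff k (\<lambda>x. 0) = (\<lambda>x. 0)" for k
    using smooth_jet[of "\<lambda>_ _. 0"] hdiff_jet[of "\<lambda>_ _. 0"] by simp_all
  then show ?thesis
    by (auto simp: Espace_iff seqop_eq_0)
qed

lemma Espace_scale: "f \<in> Espace mu \<Longrightarrow> (\<lambda>x. A * f x) \<in> Espace mu"
  using Espace_lincomb[of f mu f A 0] by simp

lemma Espace_sum: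
  assumes "finite I" "\<And>i. i \<in> I \<Longrightarrow> u i \<in> Espace mu"
  shows "(\<lambda>x. \<Sum>i\<in>I. A i * u i x) \<in> Espace mu"
  using assms
proof (induction I)
  case (insert i I)
  then show ?case
    using Espace_lincomb[of "u i" mu "\<lambda>x. \<Sum>i\<in>I. A i * u i x" "A i" 1] by simp
qed (simp add: Espace_zero)

lemma hdiff_sum:
  assumes "finite I" "\<And>i. i \<in> I \<Longrightarrow> smooth (u i)"
  shows "smooth (\<lambda>x. \<Sum>i\<in>I. A i * u i x) \<and>
    hdiff k (\<lambda>x. \<Sum>i\<in>I. A i * u i x) = (\<lambda>x. \<Sum>i\<in>I. A i * hdiff k (u i) x)"
  using assms
proof (induction I)
  case empty
  show ?case
    using smooth_jet[of "\<lambda>_ _. 0"] hdiff_jet[of "\<lambda>_ _. 0"] by simp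
next
  case (insert i I)
  then show ?case
    using smooth_lincomb[of "u i" "\<lambda>x. \<Sum>i\<in>I. A i * u i x" "A i" 1]
      hdiff_lincomb[of "u i" "\<lambda>x. \<Sum>i\<in>I. A i * u i x" k "A i" 1] by simp
qed

section \<open>Inhomogeneous equations and the Cauchy problem\<close>

lemma diffop_solvable1:
  assumes "smooth g"
  obtains f where "smooth f" "diffop [c] f = g"
proof -
  have cont: "isCont (\<lambda>x. exp (- c * of_real x) * g x) x" for x
    using has_vector_derivative_continuous[OF smooth_vector_derivative[OF assms]]
    by (intro continuous_intros)
  obtain F where F: "\<And>x. (F has_vector_derivative exp (- c * of_real x) * g x) (at x)"
    using einterval_antiderivative[of "-\<infinity>" "\<infinity>" "\<lambda>x. exp (- c * of_real x) * g x"] cont by auto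
  \<comment> \<open>Variation of constants: \<open>F\<close> is an antiderivative of exp(-c x) g(x)
    on the whole line.\<close>
  define f where "f = (\<lambda>x. exp (c * of_real x) * F x)"
  have f': "(f has_vector_derivative c * f x + g x) (at x)" for x
  proof -
    have e: "((\<lambda>x. exp (c * of_real x)) has_vector_derivative c * exp (c * of_real x)) (at x)"
      using exp_vector_derivative[of c 0 x] by simp
    have "(f has_vector_derivative
        exp (c * of_real x) * (exp (- c * of_real x) * g x) + c * exp (c * of_real x) * F x) (at x)"
      unfolding f_def by (rule has_vector_derivative_mult[OF e F])
    also have "exp (c * of_real x) * (exp (- c * of_real x) * g x) + c * exp (c * of_real x) * F x
        = c * f x + g x"
      by (simp add: f_def exp_minus)
    finally show ?thesis .
  qed
  \<comment> \<open>Differentiating f' = c f + g repeatedly dictates the derivatives of every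
    order.\<close>
  define u where "u = rec_nat f (\<lambda>k v x. c * v x + hdiff k g x)"
  have u: "u 0 = f" "\<And>k. u (Suc k) = (\<lambda>x. c * u k x + hdiff k g x)"
    by (simp_all add: u_def)
  have "(u k has_vector_derivative u (Suc k) x) (at x)" for k x
  proof (induction k)
    case 0
    then show ?case using f' u by simp
  next
    case (Suc k)
    have "((\<lambda>x. c * u k x + hdiff k g x) has_vector_derivative
        c * u (Suc k) x + hdiff (Suc k) g x) (at x)"
      by (intro has_vector_derivative_add has_vector_derivative_mult_right Suc smooth_hdiffD assms)
    then show ?case
      by (simp add: u(2) del: hdiff.simps)
  qed
  then have "smooth f"
    using smooth_jet[of u] u by simp
  moreover have "diffop [c] f = g"
    using vector_derivative_at[OF f'] by auto
  ultimately show ?thesis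
    using that by blast
qed

lemma diffop_solvable:
  assumes "smooth g"
  shows "\<exists>f. smooth f \<and> diffop cs f = g"
  using assms
proof (induction cs arbitrary: g)
  case (Cons c cs)
  from Cons.prems obtain h where h: "smooth h" "diffop [c] h = g"
    by (rule diffop_solvable1)
  with Cons.IH obtain f where "smooth f" "diffop cs f = h"
    by blast
  with h show ?case
    by (metis diffop_Cons)
qed auto

lemma diffop1_kernel:
  assumes "smooth f" "\<And>x. diffop [c] f x = 0"
  shows "f x = f y * exp (c * of_real (x - y))"
proof -
  define h where "h = (\<lambda>x. f x * exp (- c * of_real (x - y)))"
  have "(h has_vector_derivative 0) (at x)" for x
  proof -
    have e: "((\<lambda>x. exp (- c * of_real (x - y))) has_vector_derivative
        - c * exp (- c * of_real (x - y))) (at x)"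
      by (rule exp_vector_derivative)
    have "(h has_vector_derivative f x * (- c * exp (- c * of_real (x - y)))
        + hdiff (Suc 0) f x * exp (- c * of_real (x - y))) (at x)"
      unfolding h_def
      by (rule has_vector_derivative_mult[OF smooth_vector_derivative[OF assms(1)] e])
    then show ?thesis
      using assms(2)[of x] by (simp add: algebra_simps)
  qed
  then have "h x = h y"
    using has_vector_derivative_zero_constant[of UNIV h] by (metis UNIV_I convex_UNIV)
  then have "f x * exp (- c * of_real (x - y)) * exp (c * of_real (x - y))
      = f y * exp (c * of_real (x - y))"
    by (simp add: h_def)
  then show ?thesis
    by (simp add: mult.assoc exp_add[symmetric])
qed

text \<open>The outermost factor forces \<open>diffop cs f\<close> to be a multiple of an
  exponential. Its value at \<open>y\<close> involves derivatives of order at most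
  \<open>length cs\<close>, hence is zero, and the list becomes shorter.\<close>

lemma Espace_initial_zero:
  assumes "f \<in> Espace mu" "\<And>i. i < length mu \<Longrightarrow> hdiff i f y = 0"
  shows "f x = 0"
  using assms
proof (induction mu)
  case Nil
  then show ?case by (simp add: Espace_def)
next
  case (Cons c cs)
  have f: "smooth f" and "\<And>x. diffop [c] (diffop cs f) x = 0"
    using Cons.prems(1) unfolding Espace_def by auto
  then have "diffop cs f x = diffop cs f y * exp (c * of_real (x - y))" for x
    by (rule diffop1_kernel[OF smooth_diffop])
  moreover have "diffop cs f y = 0"
    using Cons.prems(2) f by (auto simp: diffop_eq_seqop intro!: seqop_eq_0)
  ultimately have "f \<in> Espace cs"
    using f by (simp add: Espace_def)
  then show ?case
    using Cons by auto
qed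

section \<open>Closure under conjugation in terms of the exponents\<close>

lemma exp_in_Espace_iff:
  "(\<lambda>x. exp (c * of_real (x - a))) \<in> Espace mu \<longleftrightarrow> c \<in> set mu"
  by (auto simp: Espace_iff smooth_exp hdiff_exp seqop_power prod_list_zero_iff simp del: of_real_diff)

text \<open>Conjugating the exponential of \<open>c\<close> shows that \<open>cnj c\<close> is an
  exponent too, but exponentials do not see multiplicities. These are reached by splitting off
  \<open>ds\<close>, a real exponent or a conjugate pair, and showing that the space of the
  remaining exponents is again closed under conjugation.\<close>

lemma cnj_closed_Espace_imp_mset:
  assumes "\<forall>g\<in>Espace mu. (\<lambda>x. cnj (g x)) \<in> Espace mu"
  shows "image_mset cnj (mset mu) = mset mu"
  using assms
proof (induction mu rule: length_induct)
  case (1 mu)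
  show ?case
  proof (cases mu)
    case (Cons c cs)
    define ds where "ds = (if c \<in> \<real> then [c] else [c, cnj c])"
    have cnj_ds: "image_mset cnj (mset ds) = mset ds"
      by (auto simp: ds_def Reals_cnj_iff)
    have "\<exists>es. mset mu = mset (ds @ es)"
    proof (cases "c \<in> \<real>")
      case False
      have "(\<lambda>x. exp (c * of_real (x - 0))) \<in> Espace mu"
        by (subst exp_in_Espace_iff) (simp add: Cons)
      then have "(\<lambda>x. exp (cnj c * of_real (x - 0))) \<in> Espace mu"
        using 1(2) by (force simp: exp_cnj)
      then have "cnj c \<in> set cs"
        using False by (subst (asm) exp_in_Espace_iff) (auto simp: Cons Reals_cnj_iff)
      then have "mset mu = mset (ds @ remove1 (cnj c) cs)"
        using False by (simp add: Cons ds_def)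
      then show ?thesis by blast
    qed (auto simp: Cons ds_def)
    then obtain es where es: "mset mu = mset (ds @ es)"
      by blast
    have E: "Espace mu = Espace (es @ ds)"
      using es by (intro Espace_mset) simp
    have app: "f \<in> Espace (es @ ds) \<longleftrightarrow> smooth f \<and> diffop ds f \<in> Espace es" for f
      by (auto simp: Espace_iff smooth_diffop seqop_append diffop_eq_seqop hdiff_diffop)
    have "\<forall>g\<in>Espace es. (\<lambda>x. cnj (g x)) \<in> Espace es"
    proof
      fix g assume g: "g \<in> Espace es"
      \<comment> \<open>Surjectivity of \<open>diffop ds\<close>: \<open>g\<close> is lifted to the
        large space, conjugated there and mapped down again. Since \<open>ds\<close> is invariant
        under conjugation, the operator commutes with it.\<close>
      then obtain f where f: "smooth f" "diffop ds f = g"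
        using diffop_solvable Espace_smooth by blast
      then have "(\<lambda>x. cnj (f x)) \<in> Espace (es @ ds)"
        using 1(2) E app g by blast
      then have "diffop ds (\<lambda>x. cnj (f x)) \<in> Espace es"
        using app by blast
      moreover have "diffop ds (\<lambda>x. cnj (f x)) x = cnj (diffop ds f x)" for x
        using f(1) cnj_ds seqop_mset[of "map cnj ds" ds]
        by (simp add: diffop_eq_seqop smooth_cnj hdiff_cnj seqop_cnj)
      ultimately show "(\<lambda>x. cnj (g x)) \<in> Espace es"
        using f by (metis (no_types, lifting) ext)
    qed
    moreover have "length es < length mu"
      using mset_eq_length[OF es] by (auto simp: ds_def split: if_splits)
    ultimately have "image_mset cnj (mset es) = mset es"
      using 1(1) by blast
    then show ?thesis
      using es cnj_ds by simp
  qed simp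
qed

lemma cnj_in_Espace:
  assumes "image_mset cnj (mset mu) = mset mu" "f \<in> Espace mu"
  shows "(\<lambda>x. cnj (f x)) \<in> Espace mu"
proof -
  have "seqop mu (\<lambda>j. cnj (hdiff j f x)) i = cnj (seqop mu (\<lambda>j. hdiff j f x) i)" for x i
    using seqop_mset[of "map cnj mu" mu] assms(1) by (simp add: seqop_cnj)
  then show ?thesis
    using assms(2) by (simp add: Espace_iff smooth_cnj hdiff_cnj)
qed

section \<open>Counting zeros\<close>

text \<open>The largest zero is split off: the other zeros give points left of \<open>z\<close>, and
  Rolle's theorem on \<open>{z..y}\<close> gives one more. All points lie in the open interval, so
  they can serve as interior zeros in the next round.\<close>

lemma Rolle_finite:
  fixes g g' :: "real \<Rightarrow> real"
  assumes "finite S" "card S = Suc N" "\<forall>x\<in>S. g x = 0" "S \<subseteq> {a..b}"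
    and "\<And>x. x \<in> {a..b} \<Longrightarrow> (g has_real_derivative g' x) (at x)"
  shows "\<exists>T. finite T \<and> card T = N \<and> T \<subseteq> {a<..<b} \<and> (\<forall>x\<in>T. g' x = 0)"
  using assms
proof (induction N arbitrary: S b)
  case 0
  then show ?case by (intro exI[of _ "{}"]) auto
next
  case (Suc N)
  define y where "y = Max S"
  define S' where "S' = S - {y}"
  define z where "z = Max S'"
  have "S \<noteq> {}" using Suc.prems by auto
  then have y: "y \<in> S" "\<And>x. x \<in> S \<Longrightarrow> x \<le> y"
    using Suc.prems(1) by (auto simp: y_def)
  have S': "finite S'" "card S' = Suc N"
    using Suc.prems y by (auto simp: S'_def)
  then have "S' \<noteq> {}" by auto
  then have z: "z \<in> S'" "\<And>x. x \<in> S' \<Longrightarrow> x \<le> z"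
    using S' by (auto simp: z_def)
  have "z < y"
    using z(1) y(2)[of z] by (auto simp: S'_def)
  have yz: "y \<le> b" "a \<le> z"
    using Suc.prems y z by (auto simp: S'_def)
  have deriv: "(g has_real_derivative g' x) (at x)" if "a \<le> x" "x \<le> y" for x
    using Suc.prems(5) that yz by auto
  obtain T where T: "finite T" "card T = N" "T \<subseteq> {a<..<z}" "\<forall>x\<in>T. g' x = 0"
  proof -
    have "\<forall>x\<in>S'. g x = 0" "S' \<subseteq> {a..z}"
      using Suc.prems(3,4) z(2) by (auto simp: S'_def subset_iff)
    moreover have "(g has_real_derivative g' x) (at x)" if "x \<in> {a..z}" for x
      using deriv[of x] that \<open>z < y\<close> by simp
    ultimately have "\<exists>T. finite T \<and> card T = N \<and> T \<subseteq> {a<..<z} \<and> (\<forall>x\<in>T. g' x = 0)"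
      using Suc.IH[of S' z] S' by blast
    then show ?thesis
      using that by blast
  qed
  have "\<exists>w. z < w \<and> w < y \<and> (g has_real_derivative 0) (at w)"
  proof (rule Rolle[OF \<open>z < y\<close>])
    show "g z = g y"
      using y z Suc.prems by (auto simp: S'_def)
    show "continuous_on {z..y} g"
      by (intro continuous_at_imp_continuous_on ballI DERIV_isCont[OF deriv]) (use yz in auto)
    show "g differentiable (at x)" if "z < x" "x < y" for x
      using deriv[of x] that yz by (auto simp: real_differentiable_def)
  qed
  then obtain w where w: "z < w" "w < y" "(g has_real_derivative 0) (at w)"
    by blast
  moreover have "g' w = 0"
    using DERIV_unique[OF deriv[of w] w(3)] w yz by simp
  moreover have "w \<notin> T"
    using T w by auto
  ultimately show ?case
    using T yz by (intro exI[of _ "insert w T"]) (simp add: subset_iff, auto)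
qed

text \<open>\<open>P\<close> and \<open>Q\<close> switch the endpoints on as additional zeros.
  Writing \<open>+ 1\<close> on the right avoids truncated subtraction when there is no zero at
  all.\<close>

lemma Rolle_count:
  fixes g g' :: "real \<Rightarrow> real"
  assumes "a < b" "finite S" "S \<subseteq> {a<..<b}" "\<forall>x\<in>S. g x = 0"
    and "P \<Longrightarrow> g a = 0" "Q \<Longrightarrow> g b = 0"
    and "\<And>x. x \<in> {a..b} \<Longrightarrow> (g has_real_derivative g' x) (at x)"
  shows "\<exists>T. finite T \<and> card S + of_bool P + of_bool Q \<le> card T + 1 \<and> T \<subseteq> {a<..<b} \<and>
    (\<forall>x\<in>T. g' x = 0)"
proof -
  define A where "A = (if P then {a} else {})"
  define B where "B = (if Q then {b} else {})"
  define S' where "S' = S \<union> A \<union> B"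
  have fin: "finite S'" and sub: "S' \<subseteq> {a..b}" and zero: "\<forall>x\<in>S'. g x = 0"
    using assms by (auto simp: S'_def A_def B_def split: if_splits)
  have "card S' = card (S \<union> A) + card B"
    unfolding S'_def using assms by (intro card_Un_disjoint) (auto simp: A_def B_def)
  also have "card (S \<union> A) = card S + card A"
    using assms by (intro card_Un_disjoint) (auto simp: A_def)
  finally have card: "card S' = card S + of_bool P + of_bool Q"
    by (auto simp: A_def B_def)
  show ?thesis
  proof (cases "card S'")
    case 0
    then show ?thesis
      using card by (intro exI[of _ "{}"]) auto
  next
    case (Suc N)
    then show ?thesis
      using Rolle_finite[OF fin Suc zero sub assms(7)] card by auto
  qed
qed

lemma Re_hdiff_deriv:
  "smooth f \<Longrightarrow> ((\<lambda>x. Re (hdiff k f x)) has_real_derivative Re (hdiff (Suc k) f x)) (at x)"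
  using bounded_linear.has_vector_derivative[OF bounded_linear_Re smooth_hdiffD[of f k x]]
  by (simp add: has_real_derivative_iff_has_vector_derivative del: hdiff.simps)

lemma Im_hdiff_deriv:
  "smooth f \<Longrightarrow> ((\<lambda>x. Im (hdiff k f x)) has_real_derivative Im (hdiff (Suc k) f x)) (at x)"
  using bounded_linear.has_vector_derivative[OF bounded_linear_Im smooth_hdiffD[of f k x]]
  by (simp add: has_real_derivative_iff_has_vector_derivative del: hdiff.simps)

lemma Im_hdiff_real:
  assumes "smooth f" "\<And>x. Im (f x) = 0"
  shows "Im (hdiff k f x) = 0"
proof (induction k arbitrary: x)
  case (Suc k)
  have "((\<lambda>x. Im (hdiff k f x)) has_real_derivative 0) (at x)"
    using Suc.IH by simp
  then show ?case
    using Im_hdiff_deriv[OF assms(1)] DERIV_unique by blast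
qed (simp add: assms)

lemma DERIV_zero_Icc_const:
  fixes g :: "real \<Rightarrow> real"
  assumes "a < b" "\<And>x. x \<in> {a..b} \<Longrightarrow> (g has_real_derivative 0) (at x)"
    and "x \<in> {a..b}" "y \<in> {a..b}"
  shows "g x = g y"
proof -
  have "g z = g a" if "z \<in> {a..b}" for z
  proof (rule DERIV_isconst2[of a b])
    show "continuous_on {a..b} g"
      by (meson assms(2) DERIV_isCont continuous_at_imp_continuous_on)
  qed (use assms that in auto)
  then show ?thesis
    using assms by metis
qed

text \<open>With the integrating factor exp(-r x), Rolle's theorem relates zeros of \<open>f\<close>
  to zeros of \<open>g\<close>. Each endpoint passes on one order less but also counts as a zero for
  Rolle's theorem, so the total drops by at most one. If \<open>g\<close> vanishes, \<open>h\<close>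
  is constant and a single zero kills it.\<close>

lemma real_factor_step:
  fixes r :: real
  assumes "a < b" "smooth f"
    and g: "\<And>x. g x = Re (hdiff 1 f x) - r * Re (f x)"
    and "finite S" "S \<subseteq> {a<..<b}" "\<forall>x\<in>S. Re (f x) = 0"
    and "k > 0 \<Longrightarrow> Re (f a) = 0" "l > 0 \<Longrightarrow> Re (f b) = 0"
  shows "\<exists>T. finite T \<and> k + l + card S \<le> (k - 1) + (l - 1) + card T + 1 \<and> T \<subseteq> {a<..<b} \<and>
      (\<forall>x\<in>T. g x = 0)"
    and "k + l + card S \<ge> 1 \<Longrightarrow> \<forall>x\<in>{a..b}. g x = 0 \<Longrightarrow> \<forall>x\<in>{a..b}. Re (f x) = 0"
proof -
  define h where "h = (\<lambda>x. exp (- r * x) * Re (f x))"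
  define F where "F = (\<lambda>i x. Re (hdiff i f x))"
  have F': "(F 0 has_real_derivative F 1 x) (at x)" for x
    unfolding F_def One_nat_def by (rule Re_hdiff_deriv[OF assms(2)])
  have h_eq: "h = (\<lambda>x. exp (- r * x) * F 0 x)" and g_eq: "g x = F 1 x - r * F 0 x" for x
    by (simp_all add: h_def g F_def)
  have h': "(h has_real_derivative exp (- r * x) * g x) (at x)" for x
    unfolding h_eq g_eq using F'[of x]
    by (auto intro!: derivative_eq_intros simp: algebra_simps)
  have "\<exists>T. finite T \<and> card S + of_bool (k > 0) + of_bool (l > 0) \<le> card T + 1 \<and>
      T \<subseteq> {a<..<b} \<and> (\<forall>x\<in>T. exp (- r * x) * g x = 0)"
    by (intro Rolle_count[where g = h] h' assms) (use assms(6-8) in \<open>auto simp: h_def\<close>)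
  then obtain T where "finite T" "card S + of_bool (k > 0) + of_bool (l > 0) \<le> card T + 1"
      "T \<subseteq> {a<..<b}" "\<forall>x\<in>T. g x = 0"
    by auto
  then show "\<exists>T. finite T \<and> k + l + card S \<le> (k - 1) + (l - 1) + card T + 1 \<and> T \<subseteq> {a<..<b} \<and>
      (\<forall>x\<in>T. g x = 0)"
    by (intro exI[of _ T]) (auto split: if_splits simp: of_bool_def)
  assume N: "k + l + card S \<ge> 1" and zero: "\<forall>x\<in>{a..b}. g x = 0"
  have "\<exists>y\<in>{a..b}. h y = 0"
  proof -
    consider "k > 0" | "l > 0" | "S \<noteq> {}"
      using N by (cases "S = {}"; cases "k > 0"; cases "l > 0") auto
    then show ?thesis
    proof cases
      case 3
      then obtain x where "x \<in> S" by blast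
      then show ?thesis
        using assms(5,6) by (intro bexI[of _ x]) (auto simp: h_def)
    qed (use assms(1,7,8) in \<open>auto simp: h_def\<close>)
  qed
  then obtain y where y: "y \<in> {a..b}" "h y = 0" by blast
  have "h x = 0" if "x \<in> {a..b}" for x
  proof -
    have "h x = h y"
    proof (rule DERIV_zero_Icc_const[OF \<open>a < b\<close> _ that y(1)])
      show "(h has_real_derivative 0) (at z)" if "z \<in> {a..b}" for z
        using h'[of z] zero that by simp
    qed
    then show ?thesis
      using y(2) by simp
  qed
  then show "\<forall>x\<in>{a..b}. Re (f x) = 0"
    by (simp add: h_def)
qed

text \<open>For a conjugate pair of exponents \<open>\<alpha> \<plusminus> i \<beta>\<close> the second order operator factors as
  \<open>g = exp (2 \<alpha> x) / w \<sqdot> D (exp (- 2 \<alpha> x) w\<^sup>2 D (f / w))\<close>, where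
  \<open>w(x) = exp (\<alpha> x) cos (\<beta> (x - m))\<close> solves the homogeneous equation, so Rolle's theorem
  applies twice. Positivity of \<open>w\<close> on \<open>[a, b]\<close> is where the length of the interval enters.\<close>

lemma conjugate_pair_step:
  fixes \<alpha> \<beta> :: real
  assumes "a < b" "smooth f" "\<bar>\<beta>\<bar> * (b - a) < pi"
    and g: "\<And>x. g x = Re (hdiff 2 f x) - 2 * \<alpha> * Re (hdiff 1 f x) + (\<alpha>\<^sup>2 + \<beta>\<^sup>2) * Re (f x)"
    and "finite S" "S \<subseteq> {a<..<b}" "\<forall>x\<in>S. Re (f x) = 0"
    and ka: "\<forall>i<k. Re (hdiff i f a) = 0" and lb: "\<forall>i<l. Re (hdiff i f b) = 0"
  shows "\<exists>T. finite T \<and> k + l + card S \<le> (k - 2) + (l - 2) + card T + 2 \<and> T \<subseteq> {a<..<b} \<and>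
      (\<forall>x\<in>T. g x = 0)"
    and "k + l + card S \<ge> 2 \<Longrightarrow> \<forall>x\<in>{a..b}. g x = 0 \<Longrightarrow> \<forall>x\<in>{a..b}. Re (f x) = 0"
proof -
  \<comment> \<open>Centring at the midpoint bounds the argument of the cosine by half of |\<beta>|
    (b - a), which is below pi/2.\<close>
  define m where "m = (a + b) / 2"
  define w where "w = (\<lambda>x. exp (\<alpha> * x) * cos (\<beta> * (x - m)))"
  define w1 where "w1 = (\<lambda>x. \<alpha> * w x - \<beta> * exp (\<alpha> * x) * sin (\<beta> * (x - m)))"
  define F where "F = (\<lambda>i x. Re (hdiff i f x))"
  have F': "(F i has_real_derivative F (Suc i) x) (at x)" for i x
    unfolding F_def by (rule Re_hdiff_deriv[OF assms(2)])
  have w': "(w has_real_derivative w1 x) (at x)" for x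
    unfolding w_def w1_def by (auto intro!: derivative_eq_intros simp: algebra_simps)
  have w1': "(w1 has_real_derivative 2 * \<alpha> * w1 x - (\<alpha>\<^sup>2 + \<beta>\<^sup>2) * w x) (at x)" for x
    using w'[of x] unfolding w1_def
    by (auto intro!: derivative_eq_intros simp: w_def algebra_simps power2_eq_square)
  have wpos: "w x > 0" if "x \<in> {a..b}" for x
  proof -
    have "\<bar>\<beta> * (x - m)\<bar> \<le> \<bar>\<beta>\<bar> * ((b - a) / 2)"
      unfolding abs_mult using that by (intro mult_left_mono) (auto simp: m_def abs_if field_simps)
    also have "\<dots> < pi / 2"
      using assms(3) by simp
    finally have "cos (\<beta> * (x - m)) > 0"
      by (intro cos_gt_zero_pi) linarith+
    then show ?thesis
      by (simp add: w_def)
  qed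
  define h0 where "h0 = (\<lambda>x. F 0 x / w x)"
  \<comment> \<open>\<open>h1\<close> is the Wronskian of \<open>F 0\<close> and \<open>w\<close>,
    the numerator of the derivative of \<open>h0\<close>. By Abel's identity its homogeneous part
    behaves like exp(2 \<alpha> x), which \<open>h2\<close> divides out.\<close>
  define h1 where "h1 = (\<lambda>x. F 1 x * w x - F 0 x * w1 x)"
  define h2 where "h2 = (\<lambda>x. exp (- 2 * \<alpha> * x) * h1 x)"
  have h0': "(h0 has_real_derivative h1 x / (w x)\<^sup>2) (at x)" if "x \<in> {a..b}" for x
    unfolding h0_def h1_def using wpos[OF that] F'[of 0 x] w'[of x]
    by (auto intro!: derivative_eq_intros simp: power2_eq_square)
  have g': "g x = F 2 x - 2 * \<alpha> * F 1 x + (\<alpha>\<^sup>2 + \<beta>\<^sup>2) * F 0 x" for x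
    by (simp add: g F_def del: hdiff.simps) simp
  have h1': "(h1 has_real_derivative w x * g x + 2 * \<alpha> * h1 x) (at x)" for x
    unfolding h1_def g' using F'[of 0 x] F'[of 1 x] w'[of x] w1'[of x]
    by (auto intro!: derivative_eq_intros simp: algebra_simps numeral_2_eq_2)
  have h2': "(h2 has_real_derivative exp (- 2 * \<alpha> * x) * (w x * g x)) (at x)" for x
    unfolding h2_def using h1'[of x]
    by (auto intro!: derivative_eq_intros simp: algebra_simps)
  have Rf: "Re (f x) = F 0 x" for x
    by (simp add: F_def)
  have "\<exists>T. finite T \<and> card S + of_bool (k > 0) + of_bool (l > 0) \<le> card T + 1 \<and>
      T \<subseteq> {a<..<b} \<and> (\<forall>x\<in>T. h1 x = 0)"
  proof -
    have "\<exists>T. finite T \<and> card S + of_bool (k > 0) + of_bool (l > 0) \<le> card T + 1 \<and>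
        T \<subseteq> {a<..<b} \<and> (\<forall>x\<in>T. h1 x / (w x)\<^sup>2 = 0)"
    proof (rule Rolle_count[where g = h0, OF \<open>a < b\<close> assms(5,6) _ _ _ h0'])
      show "\<forall>x\<in>S. h0 x = 0"
        using assms(7) by (simp add: h0_def Rf)
      show "h0 a = 0" if "k > 0"
        using ka[rule_format, OF that] by (simp add: h0_def F_def)
      show "h0 b = 0" if "l > 0"
        using lb[rule_format, OF that] by (simp add: h0_def F_def)
    qed
    then obtain T where T: "finite T" "card S + of_bool (k > 0) + of_bool (l > 0) \<le> card T + 1"
        "T \<subseteq> {a<..<b}" "\<forall>x\<in>T. h1 x / (w x)\<^sup>2 = 0"
      by blast
    have "h1 x = 0" if "x \<in> T" for x
    proof -
      have "x \<in> {a..b}"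
        using T(3) that by auto
      then have "w x \<noteq> 0"
        using wpos[of x] by simp
      then show ?thesis
        using T(4) that by auto
    qed
    with T(1-3) show ?thesis
      by blast
  qed
  then obtain S1 where S1: "finite S1" "S1 \<subseteq> {a<..<b}" "\<forall>x\<in>S1. h1 x = 0"
    "card S + of_bool (k > 0) + of_bool (l > 0) \<le> card S1 + 1"
    by blast
  \<comment> \<open>A zero of order two annihilates the Wronskian. The two indicators
    \<open>k > 0\<close> and \<open>k \<ge> 2\<close>, one for each use of Rolle's theorem, add up
    to \<open>k - (k - 2)\<close> with truncated subtraction.\<close>
  have ka': "h1 a = 0" if "k \<ge> 2"
    using ka that by (simp add: h1_def F_def del: hdiff.simps)
  have lb': "h1 b = 0" if "l \<ge> 2"
    using lb that by (simp add: h1_def F_def del: hdiff.simps)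
  have "\<exists>T. finite T \<and> card S1 + of_bool (k \<ge> 2) + of_bool (l \<ge> 2) \<le> card T + 1 \<and>
      T \<subseteq> {a<..<b} \<and> (\<forall>x\<in>T. exp (- 2 * \<alpha> * x) * (w x * g x) = 0)"
    using S1 ka' lb' by (intro Rolle_count[OF \<open>a < b\<close>, where g = h2] h2') (auto simp: h2_def)
  then obtain S2 where S2: "finite S2" "S2 \<subseteq> {a<..<b}" "\<forall>x\<in>S2. w x * g x = 0"
    "card S1 + of_bool (k \<ge> 2) + of_bool (l \<ge> 2) \<le> card S2 + 1"
    by auto
  have "g x = 0" if "x \<in> S2" for x
  proof -
    have "x \<in> {a..b}"
      using S2(2) that by auto
    then have "w x \<noteq> 0"
      using wpos[of x] by simp
    then show ?thesis
      using S2(3) that by auto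
  qed
  then show "\<exists>T. finite T \<and> k + l + card S \<le> (k - 2) + (l - 2) + card T + 2 \<and> T \<subseteq> {a<..<b} \<and>
      (\<forall>x\<in>T. g x = 0)"
    using S1(4) S2 by (intro exI[of _ S2]) (auto split: if_splits simp: of_bool_def)
  assume N: "k + l + card S \<ge> 2" and zero: "\<forall>x\<in>{a..b}. g x = 0"
  have "\<exists>y\<in>{a..b}. h1 y = 0"
  proof -
    \<comment> \<open>If neither endpoint has order two, at least two distinct zeros are present,
      and Rolle's theorem put a point of \<open>S1\<close> between them.\<close>
    have "k \<ge> 2 \<or> l \<ge> 2 \<or> card S1 > 0"
      using N S1(4) by (auto simp: of_bool_def split: if_splits)
    then consider "k \<ge> 2" | "l \<ge> 2" | "S1 \<noteq> {}"
      unfolding card_gt_0_iff by blast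
    then show ?thesis
    proof cases
      case 1
      then show ?thesis
        using ka' \<open>a < b\<close> by (intro bexI[of _ a]) auto
    next
      case 2
      then show ?thesis
        using lb' \<open>a < b\<close> by (intro bexI[of _ b]) auto
    next
      case 3
      then obtain x where "x \<in> S1" by blast
      then show ?thesis
        using S1(2,3) by (intro bexI[of _ x]) auto
    qed
  qed
  then obtain y where y: "y \<in> {a..b}" "h2 y = 0"
    by (auto simp: h2_def)
  have "h2 x = 0" if "x \<in> {a..b}" for x
  proof -
    have "h2 x = h2 y"
    proof (rule DERIV_zero_Icc_const[OF \<open>a < b\<close> _ that y(1)])
      show "(h2 has_real_derivative 0) (at z)" if "z \<in> {a..b}" for z
        using h2'[of z] zero that by simp
    qed
    then show ?thesis
      using y(2) by simp
  qed
  then have h1z: "h1 x = 0" if "x \<in> {a..b}" for x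
    using that by (simp add: h2_def)
  have "\<exists>y\<in>{a..b}. F 0 y = 0"
  proof -
    consider "k > 0" | "l > 0" | "S \<noteq> {}"
      using N by (cases "S = {}"; cases "k > 0"; cases "l > 0") auto
    then show ?thesis
    proof cases
      case 1
      then show ?thesis
        using ka \<open>a < b\<close> by (intro bexI[of _ a]) (auto simp: F_def)
    next
      case 2
      then show ?thesis
        using lb \<open>a < b\<close> by (intro bexI[of _ b]) (auto simp: F_def)
    next
      case 3
      then obtain x where "x \<in> S" by blast
      then show ?thesis
        using assms(6,7) by (intro bexI[of _ x]) (auto simp: F_def)
    qed
  qed
  then obtain v where v: "v \<in> {a..b}" "h0 v = 0"
    by (auto simp: h0_def)
  have "h0 x = 0" if "x \<in> {a..b}" for x
  proof -
    have "h0 x = h0 v"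
    proof (rule DERIV_zero_Icc_const[OF \<open>a < b\<close> _ that v(1)])
      show "(h0 has_real_derivative 0) (at z)" if "z \<in> {a..b}" for z
        using h0'[of z] h1z[of z] that by simp
    qed
    then show ?thesis
      using v(2) by simp
  qed
  then have "F 0 x / w x = 0" if "x \<in> {a..b}" for x
    using that by (simp add: h0_def)
  then show "\<forall>x\<in>{a..b}. Re (f x) = 0"
    using wpos unfolding Rf by (metis divide_eq_0_iff less_irrefl)
qed

text \<open>Removing a real exponent or a conjugate pair preserves these conditions, which makes
  them suitable for induction. The bound on imaginary parts is the one that keeps the cosine in
  \<open>conjugate_pair_step\<close> positive.\<close>

definition admissible :: "real \<Rightarrow> real \<Rightarrow> complex list \<Rightarrow> bool" where
  "admissible a b mu \<longleftrightarrow> a < b \<and> image_mset cnj (mset mu) = mset mu \<and>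
     (\<forall>c\<in>set mu. \<bar>Im c\<bar> * (b - a) < pi)"

lemma admissible_append_cancel:
  assumes "admissible a b mu" "mset mu = mset (ds @ es)" "image_mset cnj (mset ds) = mset ds"
  shows "admissible a b es"
proof -
  have "set_mset (mset mu) = set_mset (mset (ds @ es))"
    by (simp only: assms(2))
  then have "set es \<subseteq> set mu"
    by simp
  moreover have "image_mset cnj (mset ds) + image_mset cnj (mset es) = mset ds + mset es"
    using assms(1,2) unfolding admissible_def by simp
  then have "image_mset cnj (mset es) = mset es"
    unfolding assms(3) by simp
  ultimately show ?thesis
    using assms(1) unfolding admissible_def by blast
qed

lemma admissible_drop_real:
  "admissible a b mu \<Longrightarrow> mset mu = mset (of_real r # es) \<Longrightarrow> admissible a b es"
  using admissible_append_cancel[of a b mu "[of_real r]" es] by simp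

text \<open>A real exponent or a conjugate pair is removed at each stage. The number of zeros drops
  by at most the order of the operator applied, so it still suffices for the shorter list; the
  second parts of the two step lemmas carry vanishing back to \<open>f\<close>.\<close>

lemma real_Espace_zero_count:
  assumes "admissible a b mu" "f \<in> Espace mu" "\<And>x. Im (f x) = 0"
    and "\<forall>i<k. hdiff i f a = 0" "\<forall>i<l. hdiff i f b = 0"
    and "finite S" "S \<subseteq> {a<..<b}" "\<forall>x\<in>S. f x = 0" "length mu \<le> k + l + card S"
  shows "\<forall>x\<in>{a..b}. f x = 0"
  using assms
proof (induction "length mu" arbitrary: mu f k l S rule: less_induct)
  case less
  note prems = less.prems
  have "a < b"
    using prems(1) by (simp add: admissible_def)
  have f: "smooth f"
    using prems(2) by (rule Espace_smooth)
  have Im0: "Im (hdiff i f x) = 0" for i x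
    by (rule Im_hdiff_real[OF f prems(3)])
  show ?case
  proof (cases mu)
    case Nil
    then show ?thesis
      using prems(2) by (simp add: Espace_def)
  next
    case (Cons c cs)
    show ?thesis
    proof (cases "c \<in> \<real>")
      case True
      then obtain r where r: "c = of_real r"
        by (auto elim: Reals_cases)
      define g where "g = diffop [c] f"
      have g: "g \<in> Espace cs"
        using prems(2) by (simp add: g_def Cons Espace_Cons del: diffop.simps)
      have hg: "hdiff i g x = hdiff (Suc i) f x - c * hdiff i f x" for i x
        unfolding g_def by (simp add: hdiff_diffop1[OF f] del: diffop.simps hdiff.simps)
      have Re_g: "Re (g x) = Re (hdiff 1 f x) - r * Re (f x)" for x
        by (simp add: g_def r)
      have ends: "k > 0 \<Longrightarrow> Re (f a) = 0" "l > 0 \<Longrightarrow> Re (f b) = 0"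
        using prems(4,5) by (metis hdiff.simps(1) zero_complex.sel(1))+
      have SRe: "\<forall>x\<in>S. Re (f x) = 0"
        using prems(8) by simp
      note step = real_factor_step[OF \<open>a < b\<close> f Re_g prems(6,7) SRe ends]
      obtain T where T: "finite T" "k + l + card S \<le> (k - 1) + (l - 1) + card T + 1"
          "T \<subseteq> {a<..<b}" "\<forall>x\<in>T. Re (g x) = 0"
        using step(1) by blast
      have Im_g: "Im (g x) = 0" for x
        using Im0[of 1 x] prems(3)[of x] by (simp add: g_def r)
      have "\<forall>x\<in>{a..b}. g x = 0"
      proof (rule less.hyps[of cs g "k - 1" "l - 1" T])
        show "admissible a b cs"
          using admissible_drop_real[OF prems(1), of r cs] by (simp add: Cons r)
        show "\<forall>i<k - 1. hdiff i g a = 0"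
          unfolding hg using prems(4) by (simp del: hdiff.simps)
        show "\<forall>i<l - 1. hdiff i g b = 0"
          unfolding hg using prems(5) by (simp del: hdiff.simps)
        show "\<forall>x\<in>T. g x = 0"
          using T Im_g by (simp add: complex_eq_iff)
        show "length cs \<le> k - 1 + (l - 1) + card T"
          using T(2) prems(9) by (simp add: Cons)
      qed (simp_all add: Cons g Im_g T(1,3))
      then have "\<forall>x\<in>{a..b}. Re (f x) = 0"
        using step(2) prems(9) by (simp add: Cons)
      then show ?thesis
        using prems(3) by (simp add: complex_eq_iff)
    next
      case False
      define es where "es = remove1 (cnj c) cs"
      have "c \<in># image_mset cnj (mset mu)"
        using prems(1) by (simp add: admissible_def Cons)
      then have "cnj c \<in> set mu"
        by (force simp: image_iff)
      then have "cnj c \<in> set cs"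
        using False by (auto simp: Cons Reals_cnj_iff)
      then have es: "mset mu = mset ([c, cnj c] @ es)"
        by (simp add: es_def Cons)
      define g where "g = diffop [cnj c] (diffop [c] f)"
      have f1: "smooth (diffop [c] f)"
        by (rule smooth_diffop1[OF f])
      have g: "g \<in> Espace es"
        using prems(2) f1 Espace_mset[OF es]
        by (simp add: g_def Espace_Cons del: diffop.simps)
      define \<alpha> \<beta> where "\<alpha> = Re c" and "\<beta> = Im c"
      have c2: "c * cnj c = of_real (\<alpha>\<^sup>2 + \<beta>\<^sup>2)" "c + cnj c = of_real (2 * \<alpha>)"
        by (simp_all add: complex_mult_cnj complex_add_cnj \<alpha>_def \<beta>_def)
      have hg: "hdiff i g x = hdiff (Suc (Suc i)) f x - of_real (2 * \<alpha>) * hdiff (Suc i) f x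
          + of_real (\<alpha>\<^sup>2 + \<beta>\<^sup>2) * hdiff i f x" for i x
        unfolding g_def c2[symmetric]
        by (simp add: hdiff_diffop1[OF f] hdiff_diffop1[OF f1] algebra_simps
            del: diffop.simps hdiff.simps)
      have Re_g: "Re (g x) = Re (hdiff 2 f x) - 2 * \<alpha> * Re (hdiff 1 f x)
          + (\<alpha>\<^sup>2 + \<beta>\<^sup>2) * Re (f x)" for x
        using arg_cong[OF hg[of 0 x], of Re] by (simp add: numeral_2_eq_2)
      have Im_g: "Im (g x) = 0" for x
        using arg_cong[OF hg[of 0 x], of Im] Im0[of "Suc (Suc 0)" x] Im0[of "Suc 0" x] prems(3)[of x]
        by simp
      have "\<bar>\<beta>\<bar> * (b - a) < pi"
        using prems(1) by (simp add: admissible_def Cons \<beta>_def)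
      have ends: "\<forall>i<k. Re (hdiff i f a) = 0" "\<forall>i<l. Re (hdiff i f b) = 0"
        using prems(4,5) by simp_all
      have SRe: "\<forall>x\<in>S. Re (f x) = 0"
        using prems(8) by simp
      note step = conjugate_pair_step[OF \<open>a < b\<close> f \<open>\<bar>\<beta>\<bar> * (b - a) < pi\<close> Re_g prems(6,7) SRe ends]
      obtain T where T: "finite T" "k + l + card S \<le> (k - 2) + (l - 2) + card T + 2"
          "T \<subseteq> {a<..<b}" "\<forall>x\<in>T. Re (g x) = 0"
        using step(1) by blast
      have len: "length mu = length es + 2"
        using mset_eq_length[OF es] by simp
      have "\<forall>x\<in>{a..b}. g x = 0"
      proof (rule less.hyps[of es g "k - 2" "l - 2" T])
        show "admissible a b es"
          using admissible_append_cancel[OF prems(1) es] by simp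
        show "\<forall>i<k - 2. hdiff i g a = 0"
          unfolding hg using prems(4) by (simp del: hdiff.simps)
        show "\<forall>i<l - 2. hdiff i g b = 0"
          unfolding hg using prems(5) by (simp del: hdiff.simps)
        show "\<forall>x\<in>T. g x = 0"
          using T Im_g by (simp add: complex_eq_iff)
        show "length es \<le> k - 2 + (l - 2) + card T"
          using T(2) prems(9) len by simp
      qed (simp_all add: len g Im_g T(1,3))
      then have "\<forall>x\<in>{a..b}. Re (f x) = 0"
        using step(2) prems(9) len by simp
      then show ?thesis
        using prems(3) by (simp add: complex_eq_iff)
    qed
  qed
qed

lemma hdiff_zero_on_open:
  assumes "open U" "\<And>x. x \<in> U \<Longrightarrow> f x = 0" "x \<in> U"
  shows "hdiff k f x = 0"
  using assms(3)
proof (induction k arbitrary: x)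
  case (Suc k)
  have "(hdiff k f has_vector_derivative 0) (at x)"
    by (rule has_vector_derivative_transform_within_open[of "\<lambda>_. 0" _ _ U])
      (use Suc assms in auto)
  then show ?case
    by (simp add: vector_derivative_at)
qed (use assms in simp)

text \<open>Both the real and the imaginary part of \<open>f\<close> lie in the space and inherit
  its zeros, so the real case applies to each. Vanishing on the interval makes all derivatives at
  the midpoint zero, and uniqueness for the Cauchy problem extends it to the whole line.\<close>

theorem Espace_zero_count:
  assumes "admissible a b mu" "f \<in> Espace mu"
    and "\<forall>i<k. hdiff i f a = 0" "\<forall>i<l. hdiff i f b = 0"
    and "finite S" "S \<subseteq> {a<..<b}" "\<forall>x\<in>S. f x = 0" "length mu \<le> k + l + card S"
  shows "f x = 0"
proof -
  have "a < b"
    using assms(1) by (simp add: admissible_def)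
  have cnj: "(\<lambda>x. cnj (f x)) \<in> Espace mu"
    using assms(1,2) by (intro cnj_in_Espace) (auto simp: admissible_def)
  have sm: "smooth f" "smooth (\<lambda>x. cnj (f x))"
    using assms(2) cnj by (auto intro: Espace_smooth)
  have real_comb: "A * f x + B * cnj (f x) = 0"
    if real: "\<And>x. Im (A * f x + B * cnj (f x)) = 0" and x: "x \<in> {a..b}" for A B x
  proof -
    have "\<forall>x\<in>{a..b}. A * f x + B * cnj (f x) = 0"
    proof (rule real_Espace_zero_count[OF assms(1), of "\<lambda>x. A * f x + B * cnj (f x)" k l S])
      show "(\<lambda>x. A * f x + B * cnj (f x)) \<in> Espace mu"
        by (rule Espace_lincomb[OF assms(2) cnj])
    qed (use assms real in \<open>auto simp: hdiff_lincomb[OF sm] hdiff_cnj[OF sm(1)]\<close>)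
    with x show ?thesis by blast
  qed
  \<comment> \<open>The two combinations are twice the real part and twice the imaginary part of
    \<open>f\<close>.\<close>
  have zero: "f x = 0" if "x \<in> {a..b}" for x
    using real_comb[of 1 1 x] real_comb[of "- \<i>" "\<i>" x] that by (auto simp: complex_eq_iff)
  show ?thesis
  proof (rule Espace_initial_zero[OF assms(2)])
    show "hdiff i f ((a + b) / 2) = 0" for i
      using zero \<open>a < b\<close> by (intro hdiff_zero_on_open[of "{a<..<b}"]) auto
  qed
qed

section \<open>The Bernstein basis\<close>

text \<open>Gaussian elimination: the pivot \<open>A j p\<close> removes unknown \<open>p\<close>
  from the other equations, and \<open>d p\<close> is found by back substitution in equation
  \<open>j\<close>.\<close>

lemma homogeneous_system_nontrivial:
  fixes A :: "'j \<Rightarrow> 'i \<Rightarrow> 'a::field"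
  assumes "finite J" "finite I" "card J < card I"
  shows "\<exists>c. (\<exists>i\<in>I. c i \<noteq> 0) \<and> (\<forall>j\<in>J. (\<Sum>i\<in>I. c i * A j i) = 0)"
  using assms
proof (induction J arbitrary: I A rule: finite_induct)
  case empty
  then obtain i where "i \<in> I" by fastforce
  then show ?case by (intro exI[of _ "\<lambda>_. 1"]) auto
next
  case (insert j J)
  show ?case
  proof (cases "\<forall>i\<in>I. A j i = 0")
    case True
    then show ?thesis
      using insert.IH[of I A] insert.prems insert.hyps by auto
  next
    case False
    then obtain p where p: "p \<in> I" "A j p \<noteq> 0" by blast
    define I' where "I' = I - {p}"
    have I': "finite I'" "card J < card I'"
      using insert p by (auto simp: I'_def)
    from insert.IH[OF this, of "\<lambda>r i. A r i - A r p * A j i / A j p"]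
    obtain c where c: "\<exists>i\<in>I'. c i \<noteq> 0"
      "\<And>r. r \<in> J \<Longrightarrow> (\<Sum>i\<in>I'. c i * (A r i - A r p * A j i / A j p)) = 0"
      by blast
    define s where "s = (\<Sum>i\<in>I'. c i * A j i)"
    define d where "d = c(p := - s / A j p)"
    have split: "(\<Sum>i\<in>I. d i * A r i) = - s / A j p * A r p + (\<Sum>i\<in>I'. c i * A r i)" for r
    proof -
      have "(\<Sum>i\<in>I. d i * A r i) = d p * A r p + (\<Sum>i\<in>I'. d i * A r i)"
        unfolding I'_def using insert.prems p by (intro sum.remove) auto
      also have "(\<Sum>i\<in>I'. d i * A r i) = (\<Sum>i\<in>I'. c i * A r i)"
        by (intro sum.cong) (auto simp: d_def I'_def)
      finally show ?thesis by (simp add: d_def)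
    qed
    have "(\<Sum>i\<in>I. d i * A r i) = 0" if "r \<in> insert j J" for r
    proof (cases "r = j")
      case True
      then show ?thesis using p by (simp add: split s_def)
    next
      case False
      then have "0 = (\<Sum>i\<in>I'. c i * A r i - A r p / A j p * (c i * A j i))"
        using c(2)[of r] that by (simp add: algebra_simps)
      also have "\<dots> = (\<Sum>i\<in>I'. c i * A r i) - A r p / A j p * s"
        by (simp add: sum_subtractf sum_distrib_left s_def)
      finally show ?thesis by (simp add: split)
    qed
    moreover have "\<exists>i\<in>I. d i \<noteq> 0"
      using c(1) by (auto simp: d_def I'_def)
    ultimately show ?thesis by blast
  qed
qed

text \<open>The new member \<open>v\<close> solves \<open>diffop cs v = e\<close> for an exponential
  \<open>e\<close>. As \<open>e\<close> has no zero, \<open>v\<close> lies outside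
  \<open>Espace cs\<close> and is independent of the earlier members.\<close>

lemma Espace_independent_family:
  "\<exists>u. (\<forall>i<length cs. u i \<in> Espace cs) \<and>
     (\<forall>c. (\<forall>x. (\<Sum>i<length cs. c i * u i x) = 0) \<longrightarrow> (\<forall>i<length cs. c i = 0))"
proof (induction cs)
  case (Cons d cs)
  then obtain u where u: "\<And>i. i < length cs \<Longrightarrow> u i \<in> Espace cs"
    and indep: "\<And>c. \<forall>x. (\<Sum>i<length cs. c i * u i x) = 0 \<Longrightarrow> \<forall>i<length cs. c i = 0"
    by blast
  define e where "e = (\<lambda>x. exp (d * of_real (x - 0)))"
  obtain v where v: "smooth v" "diffop cs v = e"
    using diffop_solvable[OF smooth_exp[of d 0], of cs] unfolding e_def by blast
  have "e \<in> Espace [d]"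
    unfolding e_def by (subst exp_in_Espace_iff) simp
  then have vE: "v \<in> Espace (d # cs)"
    using v unfolding Espace_def by simp
  define w where "w = u(length cs := v)"
  have "w i \<in> Espace (d # cs)" if "i < length (d # cs)" for i
    using that u[of i] vE Espace_subset[of cs d] by (auto simp: w_def)
  moreover have "\<forall>i<length (d # cs). c i = 0"
    if zero: "\<forall>x. (\<Sum>i<length (d # cs). c i * w i x) = 0" for c
  proof -
    define s where "s = (\<lambda>x. \<Sum>i<length cs. c i * u i x)"
    have s: "s \<in> Espace cs"
      unfolding s_def using u by (intro Espace_sum) auto
    have eq: "s x + c (length cs) * v x = 0" for x
      using zero[rule_format, of x] by (simp add: s_def w_def)
    have "c (length cs) = 0"
    proof (rule ccontr)
      assume nz: "c (length cs) \<noteq> 0"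
      have "v = (\<lambda>x. - 1 / c (length cs) * s x)"
      proof
        fix x
        show "v x = - 1 / c (length cs) * s x"
          using eq[of x] nz by (simp add: field_simps eq_neg_iff_add_eq_0)
      qed
      then have "v \<in> Espace cs"
        using Espace_scale[OF s, of "- 1 / c (length cs)"] by simp
      then have "e 0 = 0"
        using v by (simp add: Espace_def)
      then show False
        by (simp add: e_def)
    qed
    moreover from this have "\<forall>i<length cs. c i = 0"
      using eq by (intro indep) (simp add: s_def)
    ultimately show ?thesis
      by (auto simp: less_Suc_eq)
  qed
  ultimately show ?case by blast
qed simp

text \<open>There are k + l linear conditions on more than k + l coefficients. \<open>A\<close>
  lists the conditions at \<open>a\<close> before those at \<open>b\<close>; independence turns a
  nonzero coefficient vector into a nonzero function.\<close>

lemma Espace_prescribed_zeros: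
  assumes "k + l < length mu"
  obtains f where "f \<in> Espace mu" "\<forall>i<k. hdiff i f a = 0" "\<forall>i<l. hdiff i f b = 0" "\<exists>x. f x \<noteq> 0"
proof -
  obtain u where u: "\<And>i. i < length mu \<Longrightarrow> u i \<in> Espace mu"
    and indep: "\<And>c. \<forall>x. (\<Sum>i<length mu. c i * u i x) = 0 \<Longrightarrow> \<forall>i<length mu. c i = 0"
    using Espace_independent_family by blast
  define A where "A = (\<lambda>j i. if j < k then hdiff j (u i) a else hdiff (j - k) (u i) b)"
  obtain c where c: "\<exists>i\<in>{..<length mu}. c i \<noteq> 0"
    "\<And>j. j \<in> {..<k + l} \<Longrightarrow> (\<Sum>i<length mu. c i * A j i) = 0"
    using homogeneous_system_nontrivial[of "{..<k + l}" "{..<length mu}" A] assms by auto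
  define f where "f = (\<lambda>x. \<Sum>i<length mu. c i * u i x)"
  have hf: "hdiff j f = (\<lambda>x. \<Sum>i<length mu. c i * hdiff j (u i) x)" for j
    unfolding f_def by (rule conjunct2[OF hdiff_sum]) (auto intro: Espace_smooth u)
  have "f \<in> Espace mu"
    unfolding f_def using u by (intro Espace_sum) auto
  moreover have "hdiff i f a = 0" if "i < k" for i
    using c(2)[of i] that by (simp add: hf A_def)
  moreover have "hdiff i f b = 0" if "i < l" for i
    using c(2)[of "k + i"] that by (simp add: hf A_def)
  moreover have "\<exists>x. f x \<noteq> 0"
    using indep[of c] c(1) unfolding f_def by auto
  ultimately show ?thesis
    using that by blast
qed

text \<open>A nonzero \<open>f\<close> with k zeros at \<open>a\<close> and l at \<open>b\<close>, k
  + l being one less than the dimension, cannot have one more at either end, so both orders are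
  exact and \<open>f\<close> can be normalised. Two normalised candidates agree to one more order at
  \<open>a\<close>, so their difference has too many zeros.\<close>

lemma bbasis_exists_unique:
  assumes "admissible a b mu" "k < length mu"
  shows "\<exists>!p. p \<in> Espace mu \<and> zero_order p a k \<and> zero_order p b (length mu - 1 - k) \<and> hdiff k p a = 1"
proof -
  define l where "l = length mu - 1 - k"
  have kl: "k + l < length mu" "length mu = k + l + 1"
    using assms(2) by (auto simp: l_def)
  obtain f where f: "f \<in> Espace mu" "\<forall>i<k. hdiff i f a = 0" "\<forall>i<l. hdiff i f b = 0" "\<exists>x. f x \<noteq> 0"
    using Espace_prescribed_zeros[OF kl(1)] by blast
  have ka: "hdiff k f a \<noteq> 0"
    using Espace_zero_count[OF assms(1) f(1), of "Suc k" l "{}"] f kl by (auto simp: less_Suc_eq)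
  have lb: "hdiff l f b \<noteq> 0"
    using Espace_zero_count[OF assms(1) f(1), of k "Suc l" "{}"] f kl by (auto simp: less_Suc_eq)
  define p where "p = (\<lambda>x. (1 / hdiff k f a) * f x + 0 * f x)"
  have hp: "hdiff i p x = hdiff i f x / hdiff k f a" for i x
    unfolding p_def hdiff_lincomb[OF Espace_smooth[OF f(1)] Espace_smooth[OF f(1)]] by simp
  have "p \<in> Espace mu"
    unfolding p_def by (intro Espace_lincomb f(1))
  then have p: "p \<in> Espace mu \<and> zero_order p a k \<and> zero_order p b l \<and> hdiff k p a = 1"
    using f ka lb unfolding zero_order_def hp by auto
  have "q = p" if q: "q \<in> Espace mu \<and> zero_order q a k \<and> zero_order q b l \<and> hdiff k q a = 1" for q
  proof
    fix x
    define d where "d = (\<lambda>x. 1 * q x + (-1) * p x)"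
    have sm: "smooth q" "smooth p"
      using p q by (auto intro: Espace_smooth)
    have hd: "hdiff i d x = hdiff i q x - hdiff i p x" for i x
      unfolding d_def hdiff_lincomb[OF sm] by simp
    have "d x = 0"
    proof (rule Espace_zero_count[OF assms(1), of d "Suc k" l "{}"])
      show "d \<in> Espace mu"
        unfolding d_def using p q by (intro Espace_lincomb) auto
    qed (use p q kl in \<open>auto simp: hd zero_order_def less_Suc_eq\<close>)
    then show "q x = p x" by (simp add: d_def)
  qed
  with p show ?thesis
    unfolding l_def by blast
qed

lemma bbasis_characterization:
  assumes "admissible a b mu" "k < length mu"
  shows "bbasis mu a b k \<in> Espace mu \<and> zero_order (bbasis mu a b k) a k \<and>
    zero_order (bbasis mu a b k) b (length mu - 1 - k) \<and> hdiff k (bbasis mu a b k) a = 1"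
  unfolding bbasis_def by (rule theI'[OF bbasis_exists_unique[OF assms]])

lemma
  assumes "admissible a b mu" "k < length mu"
  shows bbasis_Espace: "bbasis mu a b k \<in> Espace mu"
    and bbasis_left: "i < k \<Longrightarrow> hdiff i (bbasis mu a b k) a = 0"
    and bbasis_left_order: "hdiff k (bbasis mu a b k) a = 1"
    and bbasis_right: "j < length mu - 1 - k \<Longrightarrow> hdiff j (bbasis mu a b k) b = 0"
    and bbasis_right_order: "hdiff (length mu - 1 - k) (bbasis mu a b k) b \<noteq> 0"
  using bbasis_characterization[OF assms] unfolding zero_order_def by auto

lemma bbasis_smooth: "admissible a b mu \<Longrightarrow> k < length mu \<Longrightarrow> smooth (bbasis mu a b k)"
  by (blast intro: bbasis_Espace Espace_smooth)

text \<open>Conjugation preserves the defining conditions, so uniqueness makes the function its own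
  conjugate.\<close>

lemma bbasis_real:
  assumes "admissible a b mu" "k < length mu"
  shows "Im (bbasis mu a b k x) = 0"
proof -
  define p where "p = bbasis mu a b k"
  have sm: "smooth p"
    unfolding p_def by (rule bbasis_smooth[OF assms])
  have p: "p \<in> Espace mu \<and> zero_order p a k \<and> zero_order p b (length mu - 1 - k) \<and> hdiff k p a = 1"
    unfolding p_def by (rule bbasis_characterization[OF assms])
  moreover have "(\<lambda>x. cnj (p x)) \<in> Espace mu"
    using p assms(1) by (intro cnj_in_Espace) (auto simp: admissible_def)
  ultimately have "(\<lambda>x. cnj (p x)) = p"
    using bbasis_exists_unique[OF assms] by (auto simp: zero_order_def hdiff_cnj[OF sm])
  then have "cnj (p x) = p x" by metis
  then show ?thesis
    by (simp add: p_def complex_eq_iff)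
qed

section \<open>Leading behaviour of basis functions at the endpoints\<close>

lemma jet_taylor_limit_real:
  fixes F :: "nat \<Rightarrow> real \<Rightarrow> real"
  assumes "\<And>i x. (F i has_real_derivative F (Suc i) x) (at x)" "\<And>i. i < j \<Longrightarrow> F i y = 0"
  shows "((\<lambda>x. F 0 x / (x - y) ^ j) \<longlongrightarrow> F j y / fact j) (at y)"
  using assms
proof (induction j arbitrary: F)
  case 0
  then show ?case
    using DERIV_isCont[OF "0.prems"(1)[of 0 y]] by (simp add: isCont_def)
next
  case (Suc j)
  have lim: "((\<lambda>x. F 1 x / (x - y) ^ j) \<longlongrightarrow> F (Suc j) y / fact j) (at y)"
    using Suc.IH[of "\<lambda>i. F (Suc i)"] Suc.prems by simp
  show ?case
  proof (rule lhopital)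
    show "(F 0 \<longlongrightarrow> 0) (at y)"
      using DERIV_isCont[OF Suc.prems(1)[of 0 y]] Suc.prems(2)[of 0] by (simp add: isCont_def)
    show "((\<lambda>x. (x - y) ^ Suc j) \<longlongrightarrow> 0) (at y)"
      by (auto intro!: tendsto_eq_intros)
    have ne: "\<forall>\<^sub>F x in at y. x \<noteq> y"
      by (simp add: eventually_at_filter)
    show "\<forall>\<^sub>F x in at y. (x - y) ^ Suc j \<noteq> 0"
      and "\<forall>\<^sub>F x in at y. real (Suc j) * (x - y) ^ j \<noteq> 0"
      by (rule eventually_mono[OF ne]; simp)+
    show "\<forall>\<^sub>F x in at y. (F 0 has_real_derivative F 1 x) (at x)"
      using Suc.prems(1)[of 0] by simp
    show "\<forall>\<^sub>F x in at y. ((\<lambda>x. (x - y) ^ Suc j) has_real_derivative real (Suc j) * (x - y) ^ j) (at x)"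
      by (rule always_eventually, rule allI)
        (auto intro!: derivative_eq_intros simp del: power_Suc)
    show "((\<lambda>x. F 1 x / (real (Suc j) * (x - y) ^ j)) \<longlongrightarrow> F (Suc j) y / fact (Suc j)) (at y)"
      using tendsto_mult_left[OF lim, of "1 / real (Suc j)"]
      by (simp add: divide_simps mult.commute mult.left_commute)
  qed
qed

lemma jet_taylor_limit:
  assumes "smooth f" "\<And>i. i < j \<Longrightarrow> hdiff i f y = 0"
  shows "((\<lambda>x. f x / of_real ((x - y) ^ j)) \<longlongrightarrow> hdiff j f y / of_real (fact j)) (at y)"
proof -
  have "((\<lambda>x. Re (hdiff 0 f x) / (x - y) ^ j) \<longlongrightarrow> Re (hdiff j f y) / fact j) (at y)"
    using assms by (intro jet_taylor_limit_real[of "\<lambda>i x. Re (hdiff i f x)"] Re_hdiff_deriv) auto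
  moreover have "((\<lambda>x. Im (hdiff 0 f x) / (x - y) ^ j) \<longlongrightarrow> Im (hdiff j f y) / fact j) (at y)"
    using assms by (intro jet_taylor_limit_real[of "\<lambda>i x. Im (hdiff i f x)"] Im_hdiff_deriv) auto
  ultimately show ?thesis
    by (simp add: tendsto_complex_iff Re_divide_of_real Im_divide_of_real del: of_real_fact of_real_power)
qed

text \<open>Both functions are compared with (x - b)^j; powers and factorials cancel in the
  quotient.\<close>

lemma Lim_ratio:
  assumes "smooth f" "smooth g" "\<And>i. i < j \<Longrightarrow> hdiff i f b = 0" "\<And>i. i < j \<Longrightarrow> hdiff i g b = 0"
    and "hdiff j g b \<noteq> 0"
  shows "Lim (at_left b) (\<lambda>x. f x / g x) = hdiff j f b / hdiff j g b"
proof (rule tendsto_Lim)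
  have "((\<lambda>x. (f x / of_real ((x - b) ^ j)) / (g x / of_real ((x - b) ^ j))) \<longlongrightarrow>
      (hdiff j f b / of_real (fact j)) / (hdiff j g b / of_real (fact j))) (at_left b)"
    using assms
    by (intro tendsto_divide tendsto_mono[OF at_le[OF subset_UNIV] jet_taylor_limit]) auto
  moreover have "(hdiff j f b / of_real (fact j)) / (hdiff j g b / of_real (fact j))
      = hdiff j f b / hdiff j g b"
    by simp
  ultimately have "((\<lambda>x. (f x / of_real ((x - b) ^ j)) / (g x / of_real ((x - b) ^ j))) \<longlongrightarrow>
      hdiff j f b / hdiff j g b) (at_left b)"
    by metis
  moreover have "\<forall>\<^sub>F x in at_left b. x \<noteq> b"
    by (simp add: eventually_at_filter)
  then have "\<forall>\<^sub>F x in at_left b.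
      (f x / of_real ((x - b) ^ j)) / (g x / of_real ((x - b) ^ j)) = f x / g x"
    by (rule eventually_mono) simp
  ultimately show "((\<lambda>x. f x / g x) \<longlongrightarrow> hdiff j f b / hdiff j g b) (at_left b)"
    by (rule Lim_transform_eventually)
qed simp

text \<open>The endpoint zeros already number one less than the dimension, so an interior zero would
  exceed the bound. Near \<open>a\<close> the function behaves like (x - a)^k / k!, and by the
  intermediate value theorem the sign found there persists.\<close>

lemma bbasis_pos:
  assumes "admissible a b mu" "k < length mu" "a < x" "x < b"
  shows "Re (bbasis mu a b k x) > 0"
proof (rule ccontr)
  assume neg: "\<not> Re (bbasis mu a b k x) > 0"
  define p where "p = bbasis mu a b k"
  have sm: "smooth p"
    unfolding p_def by (rule bbasis_smooth[OF assms(1,2)])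
  have nz: "Re (p y) \<noteq> 0" if "a < y" "y < b" for y
  proof
    assume "Re (p y) = 0"
    then have py: "p y = 0"
      using bbasis_real[OF assms(1,2), of y] by (simp add: p_def complex_eq_iff)
    have "p z = 0" for z
    proof (rule Espace_zero_count[OF assms(1), of p k "length mu - 1 - k" "{y}"])
      show "p \<in> Espace mu"
        unfolding p_def by (rule bbasis_Espace[OF assms(1,2)])
    qed (use assms py that in \<open>auto simp: p_def bbasis_left bbasis_right\<close>)
    then have "hdiff k p a = 0"
      by (intro hdiff_zero_on_open[of UNIV]) auto
    then show False
      using bbasis_left_order[OF assms(1,2)] by (simp add: p_def)
  qed
  have "((\<lambda>x. Re (p x / of_real ((x - a) ^ k))) \<longlongrightarrow> Re (hdiff k p a / of_real (fact k))) (at_right a)"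
    using sm bbasis_left[OF assms(1,2)]
    by (intro tendsto_Re tendsto_mono[OF at_le[OF subset_UNIV] jet_taylor_limit]) (auto simp: p_def)
  moreover have "Re (hdiff k p a / of_real (fact k)) > 0"
    using bbasis_left_order[OF assms(1,2)] unfolding Re_divide_of_real by (simp add: p_def)
  ultimately have "\<forall>\<^sub>F x in at_right a. Re (p x / of_real ((x - a) ^ k)) > 0"
    by (rule order_tendstoD(1))
  then obtain c where c: "c > a" "\<And>y. a < y \<Longrightarrow> y < c \<Longrightarrow> Re (p y / of_real ((y - a) ^ k)) > 0"
    unfolding eventually_at_right_field by blast
  define y where "y = (a + min c x) / 2"
  have y: "a < y" "y < c" "y < x"
    using c(1) assms(3) by (auto simp: y_def min_def field_simps)
  then have py: "Re (p y) > 0"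
    using c(2)[of y] unfolding Re_divide_of_real by (simp add: zero_less_divide_iff)
  have "continuous_on {y..x} (\<lambda>x. Re (p x))"
    using DERIV_isCont[OF Re_hdiff_deriv[OF sm, of 0]]
    by (intro continuous_at_imp_continuous_on ballI) simp
  then obtain z where "y \<le> z" "z \<le> x" "Re (p z) = 0"
    using IVT2'[of "\<lambda>x. Re (p x)" x 0 y] py neg y by (force simp: p_def)
  then show False
    using nz[of z] y assms by auto
qed

text \<open>The first nonvanishing derivative at \<open>b\<close>, counterpart of the one normalised
  to 1 at \<open>a\<close>. Every limit in the definitions of nodes and weights is a quotient of two
  such numbers.\<close>

definition bend :: "complex list \<Rightarrow> real \<Rightarrow> real \<Rightarrow> nat \<Rightarrow> real" where
  "bend mu a b k = Re (hdiff (length mu - 1 - k) (bbasis mu a b k) b)"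

lemma hdiff_bbasis_end:
  assumes "admissible a b mu" "k < length mu"
  shows "hdiff (length mu - 1 - k) (bbasis mu a b k) b = of_real (bend mu a b k)"
  using Im_hdiff_real[OF bbasis_smooth[OF assms] bbasis_real[OF assms]]
  by (simp add: bend_def complex_eq_iff)

text \<open>A function that is positive to the left of \<open>b\<close> and has a zero of order j
  there has a j-th derivative of sign (-1)^j. The limit yields a weak inequality; exactness of the
  order makes it strict.\<close>

lemma bend_sign:
  assumes "admissible a b mu" "k < length mu"
  shows "(-1) ^ (length mu - 1 - k) * bend mu a b k > 0"
proof -
  define p where "p = bbasis mu a b k"
  define j where "j = length mu - 1 - k"
  have "a < b"
    using assms by (simp add: admissible_def)
  have sm: "smooth p"
    unfolding p_def by (rule bbasis_smooth[OF assms])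
  have "((\<lambda>x. Re (p x / of_real ((x - b) ^ j))) \<longlongrightarrow> Re (hdiff j p b / of_real (fact j))) (at_left b)"
    using sm bbasis_right[OF assms]
    by (intro tendsto_Re tendsto_mono[OF at_le[OF subset_UNIV] jet_taylor_limit])
      (auto simp: p_def j_def)
  then have lim: "((\<lambda>x. (-1) ^ j * (Re (p x) / (x - b) ^ j)) \<longlongrightarrow> (-1) ^ j * (bend mu a b k / fact j)) (at_left b)"
    unfolding Re_divide_of_real bend_def p_def[symmetric] j_def[symmetric] by (rule tendsto_mult_left)
  have "(-1) ^ j * (bend mu a b k / fact j) \<ge> 0"
  proof (rule tendsto_lowerbound[OF lim])
    have "0 \<le> (-1) ^ j * (Re (p x) / (x - b) ^ j)" if "a < x" "x < b" for x
    proof -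
      have "(x - b) ^ j = (-1) ^ j * (b - x) ^ j"
        by (metis minus_diff_eq mult_minus1 power_mult_distrib)
      then have "(-1) ^ j * (Re (p x) / (x - b) ^ j) = Re (p x) / (b - x) ^ j"
        by (cases "even j") auto
      then show ?thesis
        using bbasis_pos[OF assms that] that by (simp add: p_def)
    qed
    then show "\<forall>\<^sub>F x in at_left b. 0 \<le> (-1) ^ j * (Re (p x) / (x - b) ^ j)"
      unfolding eventually_at_left_field using \<open>a < b\<close> by blast
  qed simp
  then have "(-1) ^ j * (bend mu a b k / fact j) * fact j \<ge> 0"
    by (rule mult_nonneg_nonneg) simp
  then have "(-1) ^ j * bend mu a b k \<ge> 0"
    by simp
  moreover have "bend mu a b k \<noteq> 0"
    using bbasis_right_order[OF assms] hdiff_bbasis_end[OF assms] by auto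
  ultimately show ?thesis
    by (simp add: j_def less_le)
qed

section \<open>Expansion of exponentials\<close>

text \<open>Two zeros short of full order, \<open>g\<close> is determined by its leading derivatives
  at the two ends. In the extreme cases \<open>k = 0\<close> and \<open>k = Suc m\<close> one
  coefficient is zero, and the truncated indices \<open>k - 1\<close> and \<open>min k m\<close>
  keep the basis function in range.\<close>

lemma Espace_two_term:
  assumes adm: "admissible a b mu" and len: "length mu = Suc m" and g: "g \<in> Espace mu"
    and ga: "\<forall>i<k - 1. hdiff i g a = 0" and gb: "\<forall>i<m - k. hdiff i g b = 0" and k: "k \<le> Suc m"
  shows "g = (\<lambda>x. (if k > 0 then hdiff (k - 1) g a else 0) * bbasis mu a b (k - 1) x
    + (if k \<le> m then hdiff (m - k) g b / of_real (bend mu a b k) else 0) * bbasis mu a b (min k m) x)"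
    (is "g = (\<lambda>x. ?A * ?p x + ?B * ?q x)")
proof -
  have p: "k - 1 < length mu" and q: "min k m < length mu"
    using k len by auto
  have sp: "smooth ?p" "smooth ?q" and sg: "smooth g"
    using p q adm g by (auto intro: bbasis_smooth Espace_smooth)
  define d where "d = (\<lambda>x. 1 * g x + (-1) * (?A * ?p x + ?B * ?q x))"
  have hd: "hdiff i d x = hdiff i g x - (?A * hdiff i ?p x + ?B * hdiff i ?q x)" for i x
    unfolding d_def
    by (simp only: hdiff_lincomb[OF sg smooth_lincomb[OF sp]] hdiff_lincomb[OF sp]) simp
  have "d x = 0" for x
  \<comment> \<open>Each term repairs the missing derivative at one end without disturbing the
    other, which leaves \<open>k\<close> zeros at \<open>a\<close> and \<open>Suc m - k\<close> at
    \<open>b\<close>, as many as the dimension.\<close>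
  proof (rule Espace_zero_count[OF adm, of d k "Suc m - k" "{}"])
    show "d \<in> Espace mu"
      unfolding d_def using p q adm g by (intro Espace_lincomb bbasis_Espace)
    show "\<forall>i<k. hdiff i d a = 0"
    proof (intro allI impI)
      fix i assume "i < k"
      then have q0: "?B * hdiff i ?q a = 0"
        using bbasis_left[OF adm q, of i] k by auto
      show "hdiff i d a = 0"
      proof (cases "i = k - 1")
        case True
        then show ?thesis
          unfolding hd q0 using \<open>i < k\<close> bbasis_left_order[OF adm p] by (simp del: hdiff.simps)
      next
        case False
        then show ?thesis
          unfolding hd q0 using \<open>i < k\<close> bbasis_left[OF adm p, of i] ga by (simp del: hdiff.simps)
      qed
    qed
    show "\<forall>i<Suc m - k. hdiff i d b = 0"
    proof (intro allI impI)
      fix i assume i: "i < Suc m - k"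
      then have p0: "?A * hdiff i ?p b = 0"
        using bbasis_right[OF adm p, of i] len by auto
      have km: "min k m = k" "k \<le> m"
        using i by auto
      show "hdiff i d b = 0"
      proof (cases "i = m - k")
        case True
        have "bend mu a b k \<noteq> 0"
          using bend_sign[OF adm, of k] km len by auto
        then show ?thesis
          unfolding hd p0 using True km hdiff_bbasis_end[OF adm q] len by (simp del: hdiff.simps)
      next
        case False
        then show ?thesis
          unfolding hd p0 using i km gb bbasis_right[OF adm q, of i] len by (simp del: hdiff.simps)
      qed
    qed
  qed (use len k in auto)
  then have zero: "1 * g x + (-1) * (?A * ?p x + ?B * ?q x) = 0" for x
    unfolding d_def .
  have eq: "z = w" if "1 * z + (-1) * w = 0" for z w :: complex
    using that by simp
  show ?thesis
    by (rule ext) (rule eq[OF zero])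
qed

text \<open>At each end the basis function vanishes one order further than its image, so the term
  with \<open>c\<close> drops out of the leading derivative: this gives 1 at \<open>a\<close> and
  \<open>bend mu a b k\<close> at \<open>b\<close>.\<close>

lemma diffop_bbasis:
  assumes adm: "admissible a b mu" and mu: "mset mu = mset (of_real c # nu)"
    and len: "length nu = Suc m" and k: "k < length mu"
  shows "diffop [of_real c] (bbasis mu a b k) =
    (\<lambda>x. (if k > 0 then 1 else 0) * bbasis nu a b (k - 1) x
      + (if k \<le> m then of_real (bend mu a b k / bend nu a b k) else 0) * bbasis nu a b (min k m) x)"
proof -
  define p where "p = bbasis mu a b k"
  define g where "g = diffop [of_real c] p"
  have lenmu: "length mu = Suc (Suc m)"
    using mset_eq_length[OF mu] len by simp
  have sp: "smooth p"
    unfolding p_def by (rule bbasis_smooth[OF adm k])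
  have "p \<in> Espace (of_real c # nu)"
    unfolding p_def Espace_mset[OF mu, symmetric] by (rule bbasis_Espace[OF adm k])
  then have gE: "g \<in> Espace nu"
    unfolding g_def Espace_Cons by blast
  have hg: "hdiff i g x = hdiff (Suc i) p x - of_real c * hdiff i p x" for i x
    unfolding g_def hdiff_diffop1[OF sp] by simp
  have ga: "\<forall>i<k - 1. hdiff i g a = 0"
    using bbasis_left[OF adm k] by (simp add: hg p_def del: hdiff.simps)
  have gb: "\<forall>i<m - k. hdiff i g b = 0"
    using bbasis_right[OF adm k] lenmu by (simp add: hg p_def del: hdiff.simps)
  have "hdiff (k - 1) g a = 1" if "k > 0"
    using that bbasis_left[OF adm k, of "k - 1"] bbasis_left_order[OF adm k]
    by (simp add: hg p_def del: hdiff.simps)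
  moreover have "hdiff (m - k) g b = of_real (bend mu a b k)" if "k \<le> m"
    using that bbasis_right[OF adm k, of "m - k"] hdiff_bbasis_end[OF adm k] lenmu
    by (simp add: hg p_def Suc_diff_le del: hdiff.simps)
  ultimately show ?thesis
    using Espace_two_term[OF admissible_drop_real[OF adm mu] len gE ga gb] k lenmu
    unfolding g_def[symmetric] p_def[symmetric]
    by (simp add: del: hdiff.simps cong: if_cong)
qed

text \<open>Coefficients of an exponential in the basis for \<open>mu\<close>; its exponent enters
  through \<open>nu\<close>, which is \<open>mu\<close> with that exponent removed.\<close>

definition bcoef :: "complex list \<Rightarrow> complex list \<Rightarrow> real \<Rightarrow> real \<Rightarrow> nat \<Rightarrow> real" where
  "bcoef mu nu a b k = (\<Prod>l<k. - (bend mu a b l / bend nu a b l))"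

text \<open>Applying D - c to the sum \<open>F\<close>, the coefficient of the k-th basis function
  of \<open>nu\<close> is \<open>C (Suc k) + C k * E k\<close>, which is zero by the recursion. So
  \<open>F\<close> is a multiple of the exponential, and \<open>F a = C 0 = 1\<close> fixes the
  multiple.\<close>

lemma exp_expansion:
  assumes adm: "admissible a b mu" and mu: "mset mu = mset (of_real c # nu)" and nu: "nu \<noteq> []"
  shows "exp (of_real c * of_real (x - a))
    = (\<Sum>k<length mu. of_real (bcoef mu nu a b k) * bbasis mu a b k x)"
proof -
  obtain m where m: "length nu = Suc m"
    using nu by (metis length_0_conv not0_implies_Suc)
  have lenmu: "length mu = Suc (Suc m)"
    using mset_eq_length[OF mu] m by simp
  define p q where "p = bbasis mu a b" and "q = bbasis nu a b"
  define C where "C = (\<lambda>k. complex_of_real (bcoef mu nu a b k))"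
  define E where "E = (\<lambda>k. complex_of_real (bend mu a b k / bend nu a b k))"
  have C: "C (Suc k) = - C k * E k" for k
    by (simp add: C_def E_def bcoef_def)
  define F where "F = (\<lambda>x. \<Sum>k<length mu. C k * p k x)"
  have sp: "smooth (p k)" if "k \<in> {..<length mu}" for k
    using that adm by (auto simp: p_def intro: bbasis_smooth)
  have sF: "smooth F"
    unfolding F_def by (rule conjunct1[OF hdiff_sum[OF finite_lessThan sp]])
  have hF: "hdiff i F = (\<lambda>x. \<Sum>k<length mu. C k * hdiff i (p k) x)" for i
    unfolding F_def by (rule conjunct2[OF hdiff_sum[OF finite_lessThan sp]])
  have "diffop [of_real c] F x = 0" for x
  proof -
    have "diffop [of_real c] F x = (\<Sum>k<length mu. C k * diffop [of_real c] (p k) x)"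
      using fun_cong[OF hF[of "Suc 0"], of x] by (simp add: F_def sum_distrib_left sum_subtractf algebra_simps)
    also have "\<dots> = (\<Sum>k<Suc (Suc m). C k * ((if k > 0 then 1 else 0) * q (k - 1) x
        + (if k \<le> m then E k else 0) * q (min k m) x))"
      unfolding lenmu using diffop_bbasis[OF adm mu m] lenmu
      by (intro sum.cong) (auto simp: p_def q_def E_def simp del: diffop.simps)
    also have "\<dots> = (\<Sum>k<Suc (Suc m). C k * ((if k > 0 then 1 else 0) * q (k - 1) x))
        + (\<Sum>k<Suc (Suc m). C k * ((if k \<le> m then E k else 0) * q (min k m) x))"
      by (simp add: sum.distrib[symmetric] distrib_left del: sum.lessThan_Suc)
    also have "(\<Sum>k<Suc (Suc m). C k * ((if k > 0 then 1 else 0) * q (k - 1) x))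
        = (\<Sum>k<Suc m. C (Suc k) * q k x)"
      by (subst sum.lessThan_Suc_shift) simp
    also have "(\<Sum>k<Suc (Suc m). C k * ((if k \<le> m then E k else 0) * q (min k m) x))
        = (\<Sum>k<Suc m. C k * E k * q k x)"
      by (subst sum.lessThan_Suc) (auto intro!: sum.cong simp del: sum.lessThan_Suc)
    also have "(\<Sum>k<Suc m. C (Suc k) * q k x) + (\<Sum>k<Suc m. C k * E k * q k x) = 0"
      unfolding sum.distrib[symmetric] by (rule sum.neutral) (simp add: C)
    finally show ?thesis .
  qed
  then have "F x = F a * exp (of_real c * of_real (x - a))"
    by (rule diffop1_kernel[OF sF])
  moreover have "F a = 1"
  proof -
    have "p k a = (if k = 0 then 1 else 0)" if "k < length mu" for k
      using bbasis_left[OF adm that, of 0] bbasis_left_order[OF adm that] by (auto simp: p_def)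
    then have "F a = (\<Sum>k<length mu. if k = 0 then C k else 0)"
      unfolding F_def by (intro sum.cong) auto
    also have "\<dots> = C 0"
      by (subst sum.delta) (auto simp: lenmu)
    finally show ?thesis
      by (simp add: C_def bcoef_def)
  qed
  ultimately show ?thesis
    by (simp add: F_def C_def p_def)
qed

section \<open>Signs and limits of endpoint ratios\<close>

lemma bend_ratio_pos:
  assumes "admissible a b mu" "admissible a b nu" "length mu = length nu" "k < length nu"
  shows "bend mu a b k / bend nu a b k > 0"
  using bend_sign[OF assms(1), of k] bend_sign[OF assms(2), of k] assms(3,4)
  by (auto simp: zero_less_divide_iff zero_less_mult_iff)

text \<open>Lengths differing by one give \<open>bend\<close> values of opposite sign, so each
  factor with its minus sign is positive.\<close>

lemma bcoef_pos:
  assumes "admissible a b mu" "admissible a b nu" "length mu = Suc (length nu)" "k \<le> length nu"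
  shows "bcoef mu nu a b k > 0"
  unfolding bcoef_def
proof (rule prod_pos)
  fix l assume "l \<in> {..<k}"
  then have l: "l < length nu"
    using assms(4) by auto
  have "length mu - 1 - l = Suc (length nu - 1 - l)"
    using l assms(3) by simp
  then show "0 < - (bend mu a b l / bend nu a b l)"
    using bend_sign[OF assms(1), of l] bend_sign[OF assms(2), of l] l assms(3)
    by (auto simp: divide_less_0_iff zero_less_mult_iff mult_less_0_iff)
qed

lemma Lim_bbasis_ratio:
  assumes "admissible a b mu" "admissible a b nu" "length mu = length nu" "k < length nu"
  shows "Lim (at_left b) (\<lambda>x. bbasis mu a b k x / bbasis nu a b k x)
    = of_real (bend mu a b k / bend nu a b k)"
proof -
  have k: "k < length mu" "length mu - 1 - k = length nu - 1 - k"
    using assms(3,4) by simp_all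
  have "Lim (at_left b) (\<lambda>x. bbasis mu a b k x / bbasis nu a b k x)
      = hdiff (length nu - 1 - k) (bbasis mu a b k) b / hdiff (length nu - 1 - k) (bbasis nu a b k) b"
    using bbasis_right[OF assms(1) k(1)] k(2)
    by (intro Lim_ratio bbasis_smooth[OF assms(1) k(1)] bbasis_smooth[OF assms(2,4)]
        bbasis_right[OF assms(2,4)] bbasis_right_order[OF assms(2,4)]) simp_all
  then show ?thesis
    using hdiff_bbasis_end[OF assms(1) k(1)] hdiff_bbasis_end[OF assms(2,4)] k(2) by simp
qed

lemma Lim_vderiv_bbasis_ratio:
  assumes "admissible a b mu" "admissible a b nu" "length mu = Suc (length nu)" "k < length nu"
  shows "Lim (at_left b) (\<lambda>x. vector_derivative (bbasis mu a b k) (at x) / bbasis nu a b k x)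
    = of_real (bend mu a b k / bend nu a b k)"
proof -
  define p where "p = bbasis mu a b k"
  define j where "j = length nu - 1 - k"
  have k: "k < length mu" "length mu - 1 - k = Suc j"
    using assms by (auto simp: j_def)
  have sp: "smooth p"
    unfolding p_def by (rule bbasis_smooth[OF assms(1) k(1)])
  have "Lim (at_left b) (\<lambda>x. vector_derivative p (at x) / bbasis nu a b k x)
      = hdiff j (\<lambda>x. vector_derivative p (at x)) b / hdiff j (bbasis nu a b k) b"
  proof (rule Lim_ratio[OF smooth_vderiv[OF sp] bbasis_smooth[OF assms(2,4)]])
    show "hdiff i (\<lambda>x. vector_derivative p (at x)) b = 0" if "i < j" for i
      unfolding hdiff_vderiv[OF sp] unfolding p_def using bbasis_right[OF assms(1) k(1), of "Suc i"] that k(2)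
      by (simp del: hdiff.simps)
    show "hdiff i (bbasis nu a b k) b = 0" if "i < j" for i
      using bbasis_right[OF assms(2,4)] that by (simp add: j_def)
    show "hdiff j (bbasis nu a b k) b \<noteq> 0"
      using bbasis_right_order[OF assms(2,4)] by (simp add: j_def)
  qed
  then show ?thesis
    using hdiff_bbasis_end[OF assms(1) k(1)] hdiff_bbasis_end[OF assms(2,4), folded j_def] k(2)
    by (simp add: hdiff_vderiv[OF sp] p_def[symmetric] del: hdiff.simps)
qed

text \<open>The difference of the two basis functions is a multiple \<open>C\<close> of a basis function of the
  larger space. Comparing derivatives at \<open>a\<close> and at \<open>b\<close> determines the sign of \<open>C\<close>.\<close>

lemma bend_ratio_less_1:
  assumes adm: "admissible a b (of_real l0 # of_real l1 # es)" and es: "es \<noteq> []"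
    and l: "l0 < l1" and k: "k \<le> length es"
  shows "bend (of_real l0 # es) a b k / bend (of_real l1 # es) a b k < 1"
proof -
  obtain m where m: "length es = Suc m"
    using es by (metis length_0_conv not0_implies_Suc)
  define L L0 L1 where "L = complex_of_real l0 # of_real l1 # es"
    and "L0 = complex_of_real l0 # es" and "L1 = complex_of_real l1 # es"
  have adm0: "admissible a b L0" and adm1: "admissible a b L1"
    using admissible_drop_real[OF adm, of l1 L0] admissible_drop_real[OF adm, of l0 L1]
    by (simp_all add: L0_def L1_def)
  have admes: "admissible a b es"
    using admissible_drop_real[OF adm0, of l0 es] by (simp add: L0_def)
  have adm: "admissible a b L"
    using adm by (simp add: L_def)
  have len: "length L = Suc (Suc (Suc m))" "length L0 = Suc (Suc m)" "length L1 = Suc (Suc m)"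
    using m by (auto simp: L_def L0_def L1_def)
  define r q where "r = bbasis L0 a b k" and "q = bbasis L1 a b k"
  define \<rho> \<gamma> \<beta> \<upsilon> where "\<rho> = bend L0 a b k" and "\<gamma> = bend L1 a b k"
    and "\<beta> = bend L a b (Suc k)" and "\<upsilon> = bend es a b k"
  have k': "k < length L0" "k < length L1" "Suc k < length L"
    using k m len by auto
  have sm: "smooth r" "smooth q"
    using k' adm0 adm1 by (auto simp: r_def q_def intro: bbasis_smooth)
  define d where "d = (\<lambda>x. 1 * r x + (-1) * q x)"
  have hd: "hdiff i d x = hdiff i r x - hdiff i q x" for i x
    unfolding d_def hdiff_lincomb[OF sm] by simp
  have "r \<in> Espace L" "q \<in> Espace L"
  proof -
    have "r \<in> Espace L0" "q \<in> Espace L1"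
      using k' adm0 adm1 by (auto simp: r_def q_def intro: bbasis_Espace)
    moreover have "Espace L = Espace (of_real l1 # L0)"
      by (rule Espace_mset) (simp add: L_def L0_def)
    moreover have "Espace L = Espace (of_real l0 # L1)"
      by (simp add: L_def L1_def)
    ultimately show "r \<in> Espace L" "q \<in> Espace L"
      using Espace_subset by blast+
  qed
  then have dE: "d \<in> Espace L"
    unfolding d_def by (intro Espace_lincomb)
  have da: "hdiff i d a = 0" if "i \<le> k" for i
    using that bbasis_left[OF adm0 k'(1), of i] bbasis_left[OF adm1 k'(2), of i]
      bbasis_left_order[OF adm0 k'(1)] bbasis_left_order[OF adm1 k'(2)]
    by (cases "i = k") (auto simp: hd r_def q_def)
  have db: "hdiff i d b = 0" if "i < Suc m - k" for i
    using that bbasis_right[OF adm0 k'(1), of i] bbasis_right[OF adm1 k'(2), of i] len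
    by (auto simp: hd r_def q_def)
  have db': "hdiff (Suc m - k) d b = of_real (\<rho> - \<gamma>)"
    using hdiff_bbasis_end[OF adm0 k'(1)] hdiff_bbasis_end[OF adm1 k'(2)] len
    by (simp add: hd r_def q_def \<rho>_def \<gamma>_def)
  \<comment> \<open>\<open>r\<close> and \<open>q\<close> share their normalisation at
    \<open>a\<close>, so \<open>d\<close> has one zero more there. Of the two terms in
    \<open>Espace_two_term\<close> only the one with index \<open>Suc k\<close> survives.\<close>
  define C where "C = (\<rho> - \<gamma>) / \<beta>"
  have "d = (\<lambda>x. of_real C * bbasis L a b (Suc k) x)"
    using Espace_two_term[OF adm len(1) dE, of "Suc k"] da db db' k m
    by (simp add: C_def \<beta>_def min_def)
  then have "d = (\<lambda>x. of_real C * bbasis L a b (Suc k) x + 0 * bbasis L a b (Suc k) x)"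
    by simp
  then have "hdiff (Suc k) d a = of_real C"
    using hdiff_lincomb[OF bbasis_smooth[OF adm k'(3)] bbasis_smooth[OF adm k'(3)], of "Suc k" "of_real C" 0]
      bbasis_left_order[OF adm k'(3)]
    by (simp del: hdiff.simps)
  then have C1: "hdiff (Suc k) r a - hdiff (Suc k) q a = of_real C"
    unfolding hd .
  \<comment> \<open>The k-th derivatives at \<open>a\<close> of (D - l0) r and (D - l1) q are
    expanded in the basis for \<open>es\<close>. \<open>X\<close> is their common part and cancels
    in the difference.\<close>
  define X where "X = (if k > 0 then 1 else 0) * hdiff k (bbasis es a b (k - 1)) a"
  have u: "k - 1 < length es" "min k m < length es"
    using k m by auto
  have su: "smooth (bbasis es a b (k - 1))" "smooth (bbasis es a b (min k m))"
    using u admes by (auto intro: bbasis_smooth)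
  have Y: "hdiff k (bbasis es a b (min k m)) a = 1" if "k \<le> m"
    using that bbasis_left_order[OF admes u(2)] by (simp add: min_def)
  have "hdiff k (diffop [of_real l0] r) a = X + (if k \<le> m then of_real (\<rho> / \<upsilon>) else 0)"
  proof -
    have "mset L0 = mset (of_real l0 # es)"
      by (simp add: L0_def)
    from diffop_bbasis[OF adm0 this m k'(1)]
    have "diffop [of_real l0] r = (\<lambda>x. (if k > 0 then 1 else 0) * bbasis es a b (k - 1) x
        + (if k \<le> m then of_real (\<rho> / \<upsilon>) else 0) * bbasis es a b (min k m) x)"
      unfolding r_def \<rho>_def \<upsilon>_def .
    then show ?thesis
      using Y unfolding X_def by (simp only: hdiff_lincomb[OF su]) simp
  qed
  moreover have "hdiff k (diffop [of_real l1] q) a = X + (if k \<le> m then of_real (\<gamma> / \<upsilon>) else 0)"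
  proof -
    have "mset L1 = mset (of_real l1 # es)"
      by (simp add: L1_def)
    from diffop_bbasis[OF adm1 this m k'(2)]
    have "diffop [of_real l1] q = (\<lambda>x. (if k > 0 then 1 else 0) * bbasis es a b (k - 1) x
        + (if k \<le> m then of_real (\<gamma> / \<upsilon>) else 0) * bbasis es a b (min k m) x)"
      unfolding q_def \<gamma>_def \<upsilon>_def .
    then show ?thesis
      using Y unfolding X_def by (simp only: hdiff_lincomb[OF su]) simp
  qed
  ultimately have "hdiff (Suc k) r a - of_real l0 = X + (if k \<le> m then of_real (\<rho> / \<upsilon>) else 0)"
    "hdiff (Suc k) q a - of_real l1 = X + (if k \<le> m then of_real (\<gamma> / \<upsilon>) else 0)"
    using bbasis_left_order[OF adm0 k'(1), folded r_def] bbasis_left_order[OF adm1 k'(2), folded q_def]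
    unfolding hdiff_diffop1[OF sm(1)] hdiff_diffop1[OF sm(2)] by (simp_all del: hdiff.simps)
  then have "complex_of_real C = of_real (l0 - l1 + (if k \<le> m then (\<rho> - \<gamma>) / \<upsilon> else 0))"
    unfolding C1[symmetric]
    by (auto simp: algebra_simps diff_divide_distrib simp del: hdiff.simps split: if_splits)
  then have Ceq: "C = l0 - l1 + (if k \<le> m then (\<rho> - \<gamma>) / \<upsilon> else 0)"
    using of_real_eq_iff by blast
  have signs: "(-1) ^ (Suc m - k) * \<beta> > 0" "(-1) ^ (Suc m - k) * \<gamma> > 0"
    using bend_sign[OF adm k'(3)] bend_sign[OF adm1 k'(2)] len by (simp_all add: \<beta>_def \<gamma>_def)
  \<comment> \<open>For \<open>k \<le> m\<close> the equation reads C = l0 - l1 + C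
    (\<beta>/\<upsilon>) with a negative quotient, so C \<ge> 0 would make the right-hand side
    negative.\<close>
  have "C < 0"
  proof (cases "k \<le> m")
    case True
    have "(-1) ^ (m - k) * \<upsilon> > 0"
      using bend_sign[OF admes, of k] True m by (simp add: \<upsilon>_def)
    then have neg: "\<beta> / \<upsilon> < 0"
      using signs True by (auto simp: Suc_diff_le divide_less_0_iff zero_less_mult_iff mult_less_0_iff)
    have "\<beta> \<noteq> 0"
      using signs by auto
    then have eq: "(\<rho> - \<gamma>) / \<upsilon> = C * (\<beta> / \<upsilon>)"
      by (simp add: C_def)
    show ?thesis
    proof (rule ccontr)
      assume "\<not> C < 0"
      then have "C * (\<beta> / \<upsilon>) \<le> 0"
        using neg by (intro mult_nonneg_nonpos) auto
      then show False
        using Ceq l True \<open>\<not> C < 0\<close> unfolding eq by simp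
    qed
  qed (use Ceq l in simp)
  moreover have "\<beta> / \<gamma> > 0"
    using signs by (auto simp: zero_less_divide_iff zero_less_mult_iff)
  moreover have "\<rho> / \<gamma> - 1 = C * (\<beta> / \<gamma>)"
  proof -
    have "\<beta> \<noteq> 0" "\<gamma> \<noteq> 0"
      using signs by auto
    then show ?thesis
      by (simp add: C_def diff_divide_distrib[of \<rho> \<gamma> \<gamma>])
  qed
  ultimately have "\<rho> / \<gamma> - 1 < 0"
    using mult_neg_pos[of C "\<beta> / \<gamma>"] by linarith
  then show ?thesis
    unfolding \<rho>_def \<gamma>_def L0_def L1_def by linarith
qed

section \<open>Korovkin's theorem for three exponentials\<close>

text \<open>As a function of the exponent, exp(v s) is strictly convex for s \<noteq> 0, so at the
  outer nodes it exceeds its tangent at the middle node. The divided difference of an affine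
  function at three nodes is zero.\<close>

lemma exp_divided_difference_pos_sorted:
  fixes x y z s :: real
  assumes "x < y" "y < z" "s \<noteq> 0"
  shows "exp (x * s) / ((x - y) * (x - z)) + exp (y * s) / ((y - x) * (y - z))
    + exp (z * s) / ((z - x) * (z - y)) > 0"
proof -
  have tangent: "exp (v * s) > exp (y * s) * (1 + (v - y) * s)" if "v \<noteq> y" for v
  proof -
    have "1 + (v - y) * s < exp ((v - y) * s)"
      using exp_ge_add_one_self[of "(v - y) * s"] ln_eq_minus_one[of "exp ((v - y) * s)"] that assms(3)
      by (force simp: less_le)
    then have "exp (y * s) * (1 + (v - y) * s) < exp (y * s) * exp ((v - y) * s)"
      by simp
    then show ?thesis
      by (simp add: exp_add[symmetric] algebra_simps)
  qed
  have "exp (x * s) / ((y - x) * (z - x)) > exp (y * s) * (1 + (x - y) * s) / ((y - x) * (z - x))"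
    using tangent[of x] assms by (intro divide_strict_right_mono) auto
  moreover have "exp (z * s) / ((z - x) * (z - y)) > exp (y * s) * (1 + (z - y) * s) / ((z - x) * (z - y))"
    using tangent[of z] assms by (intro divide_strict_right_mono) auto
  moreover have "exp (y * s) * (1 + (x - y) * s) / ((y - x) * (z - x))
      + exp (y * s) * (1 + (z - y) * s) / ((z - x) * (z - y)) = exp (y * s) / ((y - x) * (z - y))"
  proof -
    have nz: "y - x \<noteq> 0" "z - x \<noteq> 0" "z - y \<noteq> 0"
      using assms by auto
    have "(1 + (x - y) * s) / ((y - x) * (z - x)) + (1 + (z - y) * s) / ((z - x) * (z - y))
        = 1 / ((y - x) * (z - y))"
      using nz by (simp add: divide_simps) (simp add: algebra_simps)
    then have "exp (y * s) * ((1 + (x - y) * s) / ((y - x) * (z - x)) + (1 + (z - y) * s) / ((z - x) * (z - y)))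
        = exp (y * s) * (1 / ((y - x) * (z - y)))"
      by (rule arg_cong)
    then show ?thesis
      by (simp add: distrib_left)
  qed
  moreover have "(x - y) * (x - z) = (y - x) * (z - x)"
    by (simp add: algebra_simps)
  moreover have "exp (y * s) / ((y - x) * (y - z)) = - (exp (y * s) / ((y - x) * (z - y)))"
    by (metis minus_diff_eq minus_divide_right mult_minus_right)
  ultimately show ?thesis
    by simp
qed

lemma exp_divided_difference_pos:
  fixes x y z s :: real
  assumes "x \<noteq> y" "y \<noteq> z" "x \<noteq> z" "s \<noteq> 0"
  shows "exp (x * s) / ((x - y) * (x - z)) + exp (y * s) / ((y - x) * (y - z))
    + exp (z * s) / ((z - x) * (z - y)) > 0"
proof -
  consider "x < y" "y < z" | "x < z" "z < y" | "y < x" "x < z" | "y < z" "z < x" | "z < x" "x < y" | "z < y" "y < x"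
    using assms by linarith
  then show ?thesis
    using exp_divided_difference_pos_sorted[of x y z s] exp_divided_difference_pos_sorted[of x z y s]
      exp_divided_difference_pos_sorted[of y x z s] exp_divided_difference_pos_sorted[of y z x s]
      exp_divided_difference_pos_sorted[of z x y s] exp_divided_difference_pos_sorted[of z y x s] assms(4)
    by cases (simp_all add: mult.commute add.commute add.left_commute)
qed

text \<open>The test function is \<open>\<phi>(t - x)\<close>, where \<open>\<phi>(s)\<close> is the divided
  difference of \<open>\<lambda> \<mapsto> exp (\<lambda> s)\<close> at \<open>0, m1, m2\<close>.\<close>

lemma korovkin_exponential:
  fixes a b m1 m2 :: real and h :: "real \<Rightarrow> complex" and n0 :: nat
  assumes ab: "a < b" and m: "m1 \<noteq> 0" "m2 \<noteq> 0" "m1 \<noteq> m2" and h: "continuous_on {a..b} h"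
    and W: "\<And>n k x. n \<ge> n0 \<Longrightarrow> k \<le> n \<Longrightarrow> x \<in> {a..b} \<Longrightarrow> W n k x \<ge> (0::real)"
    and t: "\<And>n k. n \<ge> n0 \<Longrightarrow> k \<le> n \<Longrightarrow> t n k \<in> {a..b}"
    and s0: "\<And>n x. n \<ge> n0 \<Longrightarrow> x \<in> {a..b} \<Longrightarrow> (\<Sum>k\<le>n. W n k x) = 1"
    and s1: "\<And>n x. n \<ge> n0 \<Longrightarrow> x \<in> {a..b} \<Longrightarrow> (\<Sum>k\<le>n. W n k x * exp (m1 * (t n k - x))) = 1"
    and s2: "\<And>\<eta>. \<eta> > 0 \<Longrightarrow> \<exists>N. \<forall>n\<ge>N. \<forall>x\<in>{a..b}. \<bar>(\<Sum>k\<le>n. W n k x * exp (m2 * (t n k - x))) - 1\<bar> \<le> \<eta>"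
    and e: "\<epsilon> > 0"
  shows "\<exists>N. \<forall>n\<ge>N. \<forall>x\<in>{a..b}. norm ((\<Sum>k\<le>n. of_real (W n k x) * h (t n k)) - h x) < \<epsilon>"
proof -
  define A where "A = 1 / ((0 - m1) * (0 - m2))"
  define B where "B = 1 / ((m1 - 0) * (m1 - m2))"
  define C where "C = 1 / ((m2 - 0) * (m2 - m1))"
  define \<phi> where "\<phi> = (\<lambda>s. A + B * exp (m1 * s) + C * exp (m2 * s))"
  have \<phi>_pos: "\<phi> s > 0" if "s \<noteq> 0" for s
    using exp_divided_difference_pos[of 0 m1 m2 s] m that by (simp add: \<phi>_def A_def B_def C_def)
  \<comment> \<open>At s = 0 the divided difference is that of a constant, so \<phi>(0) = 0 is the
    minimum.\<close>
  have ABC: "A + B + C = 0"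
    using m by (simp add: A_def B_def C_def divide_simps)
  have \<phi>_nonneg: "\<phi> s \<ge> 0" for s
    using \<phi>_pos[of s] ABC by (cases "s = 0") (auto simp: \<phi>_def)
  have "bounded (h ` {a..b})"
    using h by (intro compact_imp_bounded compact_continuous_image) auto
  then obtain K where K: "K > 0" "\<And>x. x \<in> {a..b} \<Longrightarrow> norm (h x) \<le> K"
    by (auto simp: bounded_pos)
  have "uniformly_continuous_on {a..b} h"
    using h by (intro compact_uniformly_continuous) auto
  then obtain \<delta> where \<delta>: "\<delta> > 0"
    "\<And>x y. x \<in> {a..b} \<Longrightarrow> y \<in> {a..b} \<Longrightarrow> dist y x < \<delta> \<Longrightarrow> dist (h y) (h x) < \<epsilon> / 2"
    using e unfolding uniformly_continuous_on_def by (metis half_gt_zero)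
  obtain \<mu> where \<mu>: "\<mu> > 0" "\<And>s. \<delta> \<le> \<bar>s\<bar> \<Longrightarrow> \<bar>s\<bar> \<le> b - a \<Longrightarrow> \<mu> \<le> \<phi> s"
  proof -
    \<comment> \<open>\<phi> is positive and continuous on this compact set, hence bounded below by
      a positive number there. The set is empty if \<delta> exceeds b - a, and any \<mu> will
      do.\<close>
    define D where "D = {- (b - a)..- \<delta>} \<union> {\<delta>..b - a}"
    have D: "compact D" "continuous_on D \<phi>"
      unfolding D_def \<phi>_def by (auto intro!: continuous_intros)
    have mem: "s \<in> D" if "\<delta> \<le> \<bar>s\<bar>" "\<bar>s\<bar> \<le> b - a" for s
      using that by (auto simp: D_def abs_if split: if_splits)
    show ?thesis
    proof (cases "D = {}")
      case True
      then show ?thesis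
        using mem that[of 1] by auto
    next
      case False
      then obtain s0 where s0: "s0 \<in> D" "\<And>s. s \<in> D \<Longrightarrow> \<phi> s0 \<le> \<phi> s"
        using continuous_attains_inf[OF D(1) _ D(2)] by blast
      then have "s0 \<noteq> 0"
        using \<delta>(1) by (auto simp: D_def)
      then show ?thesis
        using that[of "\<phi> s0"] \<phi>_pos mem s0 by blast
    qed
  qed
  \<comment> \<open>Chosen so that away from the diagonal 2K, the trivial bound for the oscillation
    of \<open>h\<close>, is dominated by \<open>R\<close> times \<phi>.\<close>
  define R where "R = 2 * K / \<mu>"
  have R: "R > 0"
    using K \<mu> by (simp add: R_def)
  have pointwise: "norm (h y - h x) \<le> \<epsilon> / 2 + R * \<phi> (y - x)" if "x \<in> {a..b}" "y \<in> {a..b}" for x y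
  proof (cases "\<bar>y - x\<bar> < \<delta>")
    case True
    then have "norm (h y - h x) < \<epsilon> / 2"
      using \<delta>(2)[OF that] by (simp add: dist_norm)
    moreover have "0 \<le> R * \<phi> (y - x)"
      using R \<phi>_nonneg by simp
    ultimately show ?thesis
      by linarith
  next
    case False
    then have "\<mu> \<le> \<phi> (y - x)"
      using that by (intro \<mu>(2)) auto
    then have "R * \<mu> \<le> R * \<phi> (y - x)"
      using R by simp
    moreover have "norm (h y - h x) \<le> 2 * K"
      using norm_triangle_ineq4[of "h y" "h x"] K(2)[OF that(1)] K(2)[OF that(2)] by simp
    moreover have "R * \<mu> = 2 * K"
      using \<mu>(1) by (simp add: R_def)
    ultimately show ?thesis
      using e by simp
  qed
  define D where "D = \<bar>C\<bar> + 1"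
  have D: "D > 0"
    by (simp add: D_def)
  \<comment> \<open>The first two sums are exact, so the error enters through
    \<open>C * (S - 1)\<close> alone. This choice makes its contribution at most \<epsilon>/4; the
    extra 1 in \<open>D\<close> keeps the denominator positive.\<close>
  define \<eta> where "\<eta> = \<epsilon> / (4 * R * D)"
  have \<eta>: "\<eta> > 0"
    using e R D by (simp add: \<eta>_def)
  obtain N where N: "\<And>n x. n \<ge> N \<Longrightarrow> x \<in> {a..b} \<Longrightarrow>
      \<bar>(\<Sum>k\<le>n. W n k x * exp (m2 * (t n k - x))) - 1\<bar> \<le> \<eta>"
    using s2[OF \<eta>] by blast
  show ?thesis
  proof (intro exI[of _ "max N n0"] allI impI ballI)
    fix n x assume "n \<ge> max N n0" and x: "x \<in> {a..b}"
    then have n: "n \<ge> N" "n \<ge> n0" by auto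
    define S where "S = (\<Sum>k\<le>n. W n k x * exp (m2 * (t n k - x)))"
    have "(\<Sum>k\<le>n. of_real (W n k x) * h (t n k)) - h x
        = (\<Sum>k\<le>n. of_real (W n k x) * h (t n k)) - of_real (\<Sum>k\<le>n. W n k x) * h x"
      using s0[OF n(2) x] by simp
    also have "\<dots> = (\<Sum>k\<le>n. of_real (W n k x) * (h (t n k) - h x))"
      by (simp add: sum_distrib_right sum_subtractf right_diff_distrib)
    also have "norm \<dots> \<le> (\<Sum>k\<le>n. W n k x * (\<epsilon> / 2 + R * \<phi> (t n k - x)))"
    proof (rule sum_norm_le)
      fix k assume "k \<in> {..n}"
      then have k: "k \<le> n" by simp
      show "norm (of_real (W n k x) * (h (t n k) - h x)) \<le> W n k x * (\<epsilon> / 2 + R * \<phi> (t n k - x))"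
        unfolding norm_mult norm_of_real abs_of_nonneg[OF W[OF n(2) k x]]
        by (intro mult_left_mono pointwise[OF x t[OF n(2) k]] W[OF n(2) k x])
    qed
    also have "\<dots> = \<epsilon> / 2 * (\<Sum>k\<le>n. W n k x) + R * (A * (\<Sum>k\<le>n. W n k x)
        + B * (\<Sum>k\<le>n. W n k x * exp (m1 * (t n k - x))) + C * S)"
      by (simp add: \<phi>_def S_def sum_distrib_left sum.distrib algebra_simps)
    also have "\<dots> = \<epsilon> / 2 + R * (C * (S - 1))"
      using s0[OF n(2) x] s1[OF n(2) x] ABC by (simp add: right_diff_distrib add_eq_0_iff2)
    also have "\<dots> \<le> \<epsilon> / 2 + R * (D * \<eta>)"
    proof -
      have "C * (S - 1) \<le> \<bar>C\<bar> * \<bar>S - 1\<bar>"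
        by (metis abs_ge_self abs_mult)
      also have "\<dots> \<le> D * \<eta>"
        using N[OF n(1) x] \<eta> by (intro mult_mono) (auto simp: S_def D_def)
      finally show ?thesis
        using R by simp
    qed
    also have "R * (D * \<eta>) = \<epsilon> / 4"
      using R D by (simp add: \<eta>_def)
    finally show "norm ((\<Sum>k\<le>n. of_real (W n k x) * h (t n k)) - h x) < \<epsilon>"
      using e by simp
  qed
qed

section \<open>The Bernstein operator\<close>

text \<open>Expansions of two exponentials in the same basis differ by the removed exponent, and
  \<open>bend mu\<close> cancels from the quotient of their coefficients.\<close>

lemma bcoef_change:
  assumes "\<And>l. l < k \<Longrightarrow> bend nu a b l \<noteq> 0"
  shows "bcoef mu nu' a b k = bcoef mu nu a b k * (\<Prod>l<k. bend nu a b l / bend nu' a b l)"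
proof -
  have "bcoef mu nu' a b k
      = (\<Prod>l<k. - (bend mu a b l / bend nu a b l) * (bend nu a b l / bend nu' a b l))"
    unfolding bcoef_def using assms by (intro prod.cong) auto
  then show ?thesis
    by (simp add: bcoef_def prod.distrib[symmetric])
qed

lemma bbasis_nonneg:
  assumes "admissible a b mu" "k < length mu" "x \<in> {a..b}"
  shows "Re (bbasis mu a b k x) \<ge> 0"
proof -
  consider "x = a" | "x = b" | "a < x" "x < b"
    using assms(3) by fastforce
  then show ?thesis
  proof cases
    case 1
    then show ?thesis
      using bbasis_left[OF assms(1,2), of 0] bbasis_left_order[OF assms(1,2)] by (cases "k = 0") auto
  next
    case 2
    show ?thesis
    proof (cases "length mu - 1 - k = 0")
      case True
      then show ?thesis
        using hdiff_bbasis_end[OF assms(1,2)] bend_sign[OF assms(1,2)] 2 by simp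
    next
      case False
      then show ?thesis
        using bbasis_right[OF assms(1,2), of 0] 2 by simp
    qed
  next
    case 3
    then show ?thesis
      using bbasis_pos[OF assms(1,2)] less_imp_le by blast
  qed
qed

text \<open>The k-th term of the expansion of exp(c(x - a)) divided by the exponential itself, so
  that the weights form a partition of unity.\<close>

definition bweight :: "complex list \<Rightarrow> complex list \<Rightarrow> real \<Rightarrow> real \<Rightarrow> real \<Rightarrow> nat \<Rightarrow> real \<Rightarrow> real" where
  "bweight mu nu c a b k x = exp (- c * (x - a)) * bcoef mu nu a b k * Re (bbasis mu a b k x)"

context
  fixes a b l0 l1 :: real and es :: "complex list"
  assumes adm: "admissible a b (of_real l0 # of_real l1 # es)" and es: "es \<noteq> []" and l01: "l0 < l1"
begin

text \<open>The index names the position that is removed: \<open>L0\<close> lacks \<open>l0\<close>,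
  \<open>L1\<close> lacks \<open>l1\<close>.\<close>

private abbreviation "L \<equiv> complex_of_real l0 # complex_of_real l1 # es"
private abbreviation "L0 \<equiv> complex_of_real l1 # es"
private abbreviation "L1 \<equiv> complex_of_real l0 # es"

lemma admissible_without_first: "admissible a b L0"
  using admissible_drop_real[OF adm, of l0 L0] by simp

lemma admissible_without_second: "admissible a b L1"
  using admissible_drop_real[OF adm, of l1 L1] by simp

text \<open>The limit is a positive real, so the equation for the increment has exactly one real
  solution, its logarithm over \<open>l0 - l1\<close>. This resolves the definite
  description.\<close>

lemma bnode_Suc:
  assumes "k \<le> length es"
  shows "bnode L a b (Suc k) = bnode L a b k + ln (bend L1 a b k / bend L0 a b k) / (l0 - l1)"
proof -
  define r where "r = bend L1 a b k / bend L0 a b k"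
  have r: "r > 0"
    unfolding r_def using admissible_without_first admissible_without_second assms by (intro bend_ratio_pos) auto
  have "Lim (at_left b) (\<lambda>x. bbasis L1 a b k x / bbasis L0 a b k x) = of_real r"
    unfolding r_def using admissible_without_first admissible_without_second assms by (intro Lim_bbasis_ratio) auto
  moreover have "exp (of_real d * (complex_of_real l0 - of_real l1)) = of_real r \<longleftrightarrow>
      d = ln r / (l0 - l1)" for d
  proof -
    have "exp (of_real d * (complex_of_real l0 - of_real l1)) = of_real (exp (d * (l0 - l1)))"
      by (simp add: exp_of_real[symmetric])
    then have "exp (of_real d * (complex_of_real l0 - of_real l1)) = of_real r \<longleftrightarrow> exp (d * (l0 - l1)) = r"
      by (simp only: of_real_eq_iff)
    also have "\<dots> \<longleftrightarrow> d * (l0 - l1) = ln r"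
      using r by (metis exp_ln ln_exp)
    also have "\<dots> \<longleftrightarrow> d = ln r / (l0 - l1)"
      using l01 by (simp add: eq_divide_eq)
    finally show ?thesis .
  qed
  ultimately show ?thesis
    by (simp add: r_def)
qed

lemma bnode_less_Suc:
  assumes "k \<le> length es"
  shows "bnode L a b k < bnode L a b (Suc k)"
proof -
  have "bend L1 a b k / bend L0 a b k > 0"
    using admissible_without_first admissible_without_second assms by (intro bend_ratio_pos) auto
  then have "ln (bend L1 a b k / bend L0 a b k) < 0"
    using bend_ratio_less_1[OF adm es l01 assms] by simp
  then show ?thesis
    unfolding bnode_Suc[OF assms] using l01 by (simp add: divide_neg_neg)
qed

lemma exp_bnode:
  assumes "k \<le> Suc (length es)"
  shows "exp ((l1 - l0) * (bnode L a b k - a)) = (\<Prod>l<k. bend L0 a b l / bend L1 a b l)"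
  using assms
proof (induction k)
  case (Suc k)
  define r where "r = bend L1 a b k / bend L0 a b k"
  have r: "r > 0"
    unfolding r_def using admissible_without_first admissible_without_second Suc.prems by (intro bend_ratio_pos) auto
  have "(l1 - l0) * (bnode L a b (Suc k) - a) = (l1 - l0) * (bnode L a b k - a) + (l1 - l0) * (ln r / (l0 - l1))"
    using bnode_Suc[of k] Suc.prems by (simp add: r_def algebra_simps del: bnode.simps)
  also have "(l1 - l0) * (ln r / (l0 - l1)) = - ln r"
    using l01 by (simp add: field_simps)
  finally have "exp ((l1 - l0) * (bnode L a b (Suc k) - a)) = exp ((l1 - l0) * (bnode L a b k - a)) * inverse r"
    using r by (simp add: exp_diff divide_inverse del: bnode.simps)
  then show ?case
    using Suc by (simp add: r_def del: bnode.simps)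
qed simp

text \<open>The sign (-1)^k in the definition is absorbed by the minus signs in the factors of
  \<open>bcoef\<close>.\<close>

lemma balpha_eq:
  assumes "k \<le> Suc (length es)"
  shows "balpha L a b k = of_real (exp (- l0 * (bnode L a b k - a)) * bcoef L L0 a b k)"
proof -
  have "(\<Prod>l<k. Lim (at_left b) (\<lambda>x. vector_derivative (bbasis L a b l) (at x) / bbasis L0 a b l x))
      = (\<Prod>l<k. of_real (bend L a b l / bend L0 a b l))"
    using assms adm admissible_without_first by (intro prod.cong refl Lim_vderiv_bbasis_ratio) auto
  moreover have "bcoef L L0 a b k = (-1) ^ k * (\<Prod>l<k. bend L a b l / bend L0 a b l)"
    unfolding bcoef_def by (simp add: prod_uminus)
  moreover have "exp (- complex_of_real l0 * of_real (bnode L a b k - a))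
      = of_real (exp (- l0 * (bnode L a b k - a)))"
    by (simp add: exp_of_real[symmetric])
  ultimately show ?thesis
    by (simp add: balpha_def del: of_real_diff)
qed

lemma exp_expansion_real:
  assumes "mset L = mset (of_real c # nu)"
  shows "exp (c * (x - a)) = (\<Sum>k\<le>Suc (length es). bcoef L nu a b k * Re (bbasis L a b k x))"
proof -
  have "nu \<noteq> []"
    using mset_eq_length[OF assms] by auto
  then have "exp (of_real c * of_real (x - a)) =
      (\<Sum>k<length L. of_real (bcoef L nu a b k) * bbasis L a b k x)"
    by (rule exp_expansion[OF adm assms])
  then have "Re (exp (of_real c * of_real (x - a))) =
      (\<Sum>k<length L. bcoef L nu a b k * Re (bbasis L a b k x))"
    by simp
  moreover have "Re (exp (of_real c * of_real (x - a))) = exp (c * (x - a))"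
    by (metis Re_complex_of_real exp_of_real of_real_mult)
  ultimately show ?thesis
    by (simp add: lessThan_Suc_atMost)
qed

text \<open>The nodes are made for this identity: it says that weights reproducing the exponential
  of \<open>l0\<close> at the nodes also reproduce that of \<open>l1\<close>.\<close>

lemma bcoef_without_second:
  assumes "k \<le> Suc (length es)"
  shows "bcoef L L1 a b k = bcoef L L0 a b k * exp ((l1 - l0) * (bnode L a b k - a))"
  unfolding exp_bnode[OF assms]
proof (rule bcoef_change)
  fix l assume "l < k"
  then show "bend L0 a b l \<noteq> 0"
    using bend_sign[OF admissible_without_first, of l] assms by auto
qed

text \<open>At \<open>b\<close> all basis functions but the last vanish. Dividing the two expansions
  evaluated there leaves an equation of exponentials for the last node.\<close>

lemma bnode_last: "bnode L a b (Suc (length es)) = b"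
proof -
  define n where "n = Suc (length es)"
  have "Re (bbasis L a b k b) = 0" if "k < n" for k
    using bbasis_right[OF adm, of k 0] that by (simp add: n_def)
  then have last: "(\<Sum>k\<le>n. C k * Re (bbasis L a b k b)) = C n * Re (bbasis L a b n b)" for C
    unfolding lessThan_Suc_atMost[symmetric] by simp
  have e0: "exp (l0 * (b - a)) = bcoef L L0 a b n * Re (bbasis L a b n b)"
    using exp_expansion_real[of l0 L0 b] last unfolding n_def by simp
  have "exp (l1 * (b - a)) = bcoef L L1 a b n * Re (bbasis L a b n b)"
    using exp_expansion_real[of l1 L1 b] last unfolding n_def by simp
  also have "\<dots> = exp (l0 * (b - a)) * exp ((l1 - l0) * (bnode L a b n - a))"
    unfolding e0 using bcoef_without_second[of n] by (simp add: n_def del: bnode.simps)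
  finally have "l1 * (b - a) = l0 * (b - a) + (l1 - l0) * (bnode L a b n - a)"
    by (simp add: exp_add[symmetric] del: bnode.simps)
  then have "(l1 - l0) * (bnode L a b n - b) = 0"
    by (simp add: algebra_simps del: bnode.simps)
  then show ?thesis
    using l01 by (simp add: n_def del: bnode.simps)
qed

lemma bnode_in_interval:
  assumes "k \<le> Suc (length es)"
  shows "bnode L a b k \<in> {a..b}"
proof -
  have mono: "bnode L a b i \<le> bnode L a b j" if "i \<le> j" "j \<le> Suc (length es)" for i j
    using that
  proof (induction j rule: dec_induct)
    case (step j)
    then show ?case
      using bnode_less_Suc[of j] by (simp del: bnode.simps)
  qed simp
  show ?thesis
    using mono[of 0 k] mono[of k "Suc (length es)"] bnode_last assms by (simp del: bnode.simps(2))
qed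

lemma bweight_nonneg: "k \<le> Suc (length es) \<Longrightarrow> x \<in> {a..b} \<Longrightarrow> bweight L L0 l0 a b k x \<ge> 0"
  unfolding bweight_def using bcoef_pos[OF adm admissible_without_first, of k] bbasis_nonneg[OF adm, of k x]
  by simp

lemma sum_bweight: "(\<Sum>k\<le>Suc (length es). bweight L L0 l0 a b k x) = 1"
proof -
  have "(\<Sum>k\<le>Suc (length es). bweight L L0 l0 a b k x) = exp (- l0 * (x - a)) * exp (l0 * (x - a))"
    unfolding exp_expansion_real[OF refl]
    by (simp add: bweight_def sum_distrib_left mult.assoc del: sum.atMost_Suc)
  then show ?thesis
    by (simp add: exp_minus)
qed

lemma sum_bweight_l1: "(\<Sum>k\<le>Suc (length es). bweight L L0 l0 a b k x * exp ((l1 - l0) * (bnode L a b k - x))) = 1"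
proof -
  have "(\<Sum>k\<le>Suc (length es). bweight L L0 l0 a b k x * exp ((l1 - l0) * (bnode L a b k - x)))
      = (\<Sum>k\<le>Suc (length es). exp (- l1 * (x - a)) * (bcoef L L1 a b k * Re (bbasis L a b k x)))"
  proof (intro sum.cong refl)
    fix k assume "k \<in> {..Suc (length es)}"
    then have "bcoef L L1 a b k = bcoef L L0 a b k * exp ((l1 - l0) * (bnode L a b k - a))"
      by (intro bcoef_without_second) simp
    moreover have "exp (- l0 * (x - a)) * exp ((l1 - l0) * (bnode L a b k - x))
        = exp (- l1 * (x - a)) * exp ((l1 - l0) * (bnode L a b k - a))"
      unfolding exp_add[symmetric] by (simp add: algebra_simps)
    moreover have "u * c * p * v = u' * (c * v' * p)" if "u * v = u' * v'" for u v u' v' c p :: real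
      using arg_cong[OF that, of "\<lambda>z. z * (c * p)"] by (simp only: ac_simps)
    ultimately show "bweight L L0 l0 a b k x * exp ((l1 - l0) * (bnode L a b k - x))
        = exp (- l1 * (x - a)) * (bcoef L L1 a b k * Re (bbasis L a b k x))"
      unfolding bweight_def by presburger
  qed
  also have "\<dots> = exp (- l1 * (x - a)) * exp (l1 * (x - a))"
    using exp_expansion_real[of l1 L1 x] by (simp add: sum_distrib_left del: sum.atMost_Suc)
  finally show ?thesis
    by (simp add: exp_minus)
qed

text \<open>Dividing by the exponential of \<open>l0\<close> turns the operator into averaging with
  nonnegative weights of total mass 1, the form to which the Korovkin argument applies.\<close>

lemma bop_eq_bweight:
  "bop L a b f x = of_real (exp (l0 * x)) *
     (\<Sum>k\<le>Suc (length es). of_real (bweight L L0 l0 a b k x) * (of_real (exp (- l0 * bnode L a b k)) * f (bnode L a b k)))"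
proof -
  have "balpha L a b k * f (bnode L a b k) * bbasis L a b k x = of_real (exp (l0 * x)) *
      (of_real (bweight L L0 l0 a b k x) * (of_real (exp (- l0 * bnode L a b k)) * f (bnode L a b k)))"
    if k: "k \<le> Suc (length es)" for k
  proof -
    have p: "bbasis L a b k x = of_real (Re (bbasis L a b k x))"
      using bbasis_real[OF adm, of k x] k by (simp add: complex_eq_iff)
    have e: "exp (- l0 * (bnode L a b k - a)) = exp (l0 * x) * exp (- l0 * (x - a)) * exp (- l0 * bnode L a b k)"
      unfolding exp_add[symmetric] by (simp add: algebra_simps)
    show ?thesis
      unfolding balpha_eq[OF k] bweight_def e by (subst p) (simp only: of_real_mult ac_simps)
  qed
  then show ?thesis
    unfolding bop_def sum_distrib_left by (intro sum.cong) (simp_all del: bnode.simps)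
qed

end

section \<open>Asymptotic reproduction of the third exponential, and convergence\<close>

lemma sum_bweight_l2_bound:
  fixes a b l0 l1 l2 \<epsilon> x :: real and fs :: "complex list"
  defines "L \<equiv> complex_of_real l0 # of_real l1 # of_real l2 # fs"
    and "L0 \<equiv> complex_of_real l1 # of_real l2 # fs"
    and "L2 \<equiv> complex_of_real l0 # of_real l1 # fs"
    and "n \<equiv> Suc (Suc (length fs))"
  assumes adm: "admissible a b L" and l01: "l0 < l1" and \<epsilon>: "\<epsilon> > 0" and x: "x \<in> {a..b}"
    and hyp: "\<And>k. k < n \<Longrightarrow> \<bar>ln (bend L2 a b k / bend L0 a b k) / (bnode L a b k - bnode L a b (Suc k))
      - (l2 - l0)\<bar> < \<epsilon>"
  shows "\<bar>(\<Sum>k\<le>n. bweight L L0 l0 a b k x * exp ((l2 - l0) * (bnode L a b k - x))) - 1\<bar>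
    \<le> exp (\<epsilon> * (b - a)) - 1"
proof -
  define es where "es = complex_of_real l2 # fs"
  have es: "es \<noteq> []" "Suc (length es) = n" "L = of_real l0 # of_real l1 # es" "L0 = of_real l1 # es"
    by (auto simp: es_def n_def L_def L0_def)
  note adm' = adm[unfolded es(3)]
  define t where "t = bnode L a b"
  define m where "m = l2 - l0"
  \<comment> \<open>The exact quotient of the coefficients for \<open>l2\<close> and
    \<open>l0\<close>; reproduction of the third exponential would require it to equal exp(m (t_k -
    a)).\<close>
  define E where "E = (\<lambda>k. \<Prod>l<k. bend L0 a b l / bend L2 a b l)"
  have admL0: "admissible a b L0" and admL2: "admissible a b L2"
    using admissible_drop_real[OF adm, of l0 L0] admissible_drop_real[OF adm, of l2 L2]
    by (simp_all add: L_def L0_def L2_def)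
  have len: "length L0 = n" "length L2 = n" "length L = Suc n"
    by (simp_all add: L_def L0_def L2_def n_def)
  have ratio: "bend L2 a b k / bend L0 a b k > 0" if "k < n" for k
    using that len by (intro bend_ratio_pos admL0 admL2) auto
  have Epos: "E k > 0" if "k \<le> n" for k
    unfolding E_def using that len by (intro prod_pos bend_ratio_pos admL0 admL2) auto
  have step: "t k < t (Suc k)" if "k < n" for k
    using bnode_less_Suc[OF adm' es(1) l01, of k] that es(2) unfolding t_def es(3) by simp
  have t: "t k \<in> {a..b}" if "k \<le> n" for k
    using bnode_in_interval[OF adm' es(1) l01, of k] that es(2) unfolding t_def es(3) by simp
  \<comment> \<open>The hypothesis, multiplied by the gap between two nodes, is an error per factor.
    These errors telescope to \<epsilon> times the distance from \<open>a\<close>.\<close>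
  have log_bound: "\<bar>ln (E k) - m * (t k - a)\<bar> \<le> \<epsilon> * (t k - a)" if "k \<le> n" for k
    using that
  proof (induction k)
    case 0
    then show ?case by (simp add: E_def t_def)
  next
    case (Suc k)
    define d where "d = t (Suc k) - t k"
    define r where "r = bend L2 a b k / bend L0 a b k"
    have d: "d > 0"
      using step[of k] Suc.prems by (simp add: d_def)
    have r: "r > 0"
      using ratio[of k] Suc.prems by (simp add: r_def)
    have "E (Suc k) = E k / r"
      by (simp add: E_def r_def)
    then have E: "ln (E (Suc k)) = ln (E k) - ln r"
      using Epos[of k] r Suc.prems by (simp add: ln_div)
    have "\<bar>ln r / (- d) - m\<bar> < \<epsilon>"
      using hyp[of k] Suc.prems by (simp add: r_def d_def m_def t_def del: bnode.simps)
    then have "\<bar>ln r / (- d) - m\<bar> * d \<le> \<epsilon> * d"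
      using d by (intro mult_right_mono) auto
    also have "\<bar>ln r / (- d) - m\<bar> * d = \<bar>(ln r / (- d) - m) * d\<bar>"
      using d by (simp add: abs_mult)
    also have "(ln r / (- d) - m) * d = - ln r - m * d"
      using d by (simp add: field_simps)
    finally have "\<bar>- ln r - m * d\<bar> \<le> \<epsilon> * d" .
    moreover have "ln (E (Suc k)) - m * (t (Suc k) - a) = (ln (E k) - m * (t k - a)) + (- ln r - m * d)"
      unfolding E d_def by (simp add: algebra_simps)
    moreover have "\<epsilon> * (t (Suc k) - a) = \<epsilon> * (t k - a) + \<epsilon> * d"
      by (simp add: d_def algebra_simps)
    ultimately show ?case
      using Suc by linarith
  qed
  define \<delta> where "\<delta> = \<epsilon> * (b - a)"
  have E_bound: "\<bar>exp (m * (t k - a)) - E k\<bar> \<le> (exp \<delta> - 1) * E k" if "k \<le> n" for k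
  proof -
    define u where "u = m * (t k - a) - ln (E k)"
    have "\<epsilon> * (t k - a) \<le> \<delta>"
      unfolding \<delta>_def using t[OF that] \<epsilon> by (intro mult_left_mono) auto
    then have u: "\<bar>u\<bar> \<le> \<delta>"
      using log_bound[OF that] by (simp add: u_def abs_minus_commute)
    have "exp u \<le> exp \<delta>" "exp (- \<delta>) \<le> exp u"
      using u by auto
    \<comment> \<open>This gives 1 - exp(-\<delta>) \<le> exp(\<delta>) - 1, so one bound covers
      deviations of exp(u) from 1 in both directions.\<close>
    moreover have "2 \<le> exp \<delta> + exp (- \<delta>)"
      using exp_ge_add_one_self[of \<delta>] exp_ge_add_one_self[of "- \<delta>"] by linarith
    ultimately have "\<bar>exp u - 1\<bar> \<le> exp \<delta> - 1"
      by linarith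
    then have "\<bar>exp u - 1\<bar> * E k \<le> (exp \<delta> - 1) * E k"
      using Epos[OF that] by (intro mult_right_mono) auto
    moreover have "exp (m * (t k - a)) = exp u * E k"
      using Epos[OF that] by (simp add: u_def exp_diff)
    then have "\<bar>exp (m * (t k - a)) - E k\<bar> = \<bar>(exp u - 1) * E k\<bar>"
      by (simp add: left_diff_distrib)
    ultimately show ?thesis
      using Epos[OF that] unfolding abs_mult by simp
  qed
  \<comment> \<open>The weights renormalised from \<open>l0\<close> to \<open>l2\<close>:
    \<open>w k * E k\<close> are the terms of the exact expansion for \<open>l2\<close> divided by
    that exponential, hence their sum is 1.\<close>
  define w where "w = (\<lambda>k. bweight L L0 l0 a b k x * exp (- m * (x - a)))"
  have w: "w k \<ge> 0" if "k \<le> n" for k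
    unfolding w_def using bweight_nonneg[OF adm' es(1) l01, of k x] that es(2) x
    unfolding es(3,4) by simp
  have wE: "(\<Sum>k\<le>n. w k * E k) = 1"
  proof -
    have "mset (complex_of_real l0 # of_real l1 # es) = mset (of_real l2 # L2)"
      by (simp add: es_def L2_def)
    from exp_expansion_real[OF adm' es(1) l01 this, of x]
    have "exp (l2 * (x - a)) = (\<Sum>k\<le>n. bcoef L L2 a b k * Re (bbasis L a b k x))"
      unfolding es(2) es(3)[symmetric] .
    also have "\<dots> = (\<Sum>k\<le>n. exp (l2 * (x - a)) * (w k * E k))"
    proof (intro sum.cong refl)
      fix k assume "k \<in> {..n}"
      then have k: "k \<le> n" by simp
      have "bcoef L L2 a b k = bcoef L L0 a b k * E k"
        unfolding E_def
      proof (rule bcoef_change)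
        fix l assume "l < k"
        then show "bend L0 a b l \<noteq> 0"
          using bend_sign[OF admL0, of l] k len by auto
      qed
      moreover have "exp (l2 * (x - a)) * (exp (- l0 * (x - a)) * exp (- m * (x - a))) = 1"
        unfolding exp_add[symmetric] by (simp add: m_def algebra_simps)
      ultimately show "bcoef L L2 a b k * Re (bbasis L a b k x) = exp (l2 * (x - a)) * (w k * E k)"
        unfolding w_def bweight_def
        by (simp add: ac_simps)
    qed
    finally show ?thesis
      by (simp add: sum_distrib_left[symmetric])
  qed
  have "(\<Sum>k\<le>n. bweight L L0 l0 a b k x * exp (m * (t k - x))) - 1
      = (\<Sum>k\<le>n. w k * exp (m * (t k - a))) - (\<Sum>k\<le>n. w k * E k)"
    unfolding wE by (simp add: w_def mult.assoc exp_add[symmetric] algebra_simps)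
  also have "\<dots> = (\<Sum>k\<le>n. w k * (exp (m * (t k - a)) - E k))"
    by (simp add: sum_subtractf right_diff_distrib)
  also have "\<bar>\<dots>\<bar> \<le> (\<Sum>k\<le>n. \<bar>w k * (exp (m * (t k - a)) - E k)\<bar>)"
    by (rule sum_abs)
  also have "\<dots> \<le> (\<Sum>k\<le>n. w k * ((exp \<delta> - 1) * E k))"
  proof (rule sum_mono)
    fix k assume "k \<in> {..n}"
    then have k: "k \<le> n" by simp
    show "\<bar>w k * (exp (m * (t k - a)) - E k)\<bar> \<le> w k * ((exp \<delta> - 1) * E k)"
      unfolding abs_mult abs_of_nonneg[OF w[OF k]] by (rule mult_left_mono[OF E_bound[OF k] w[OF k]])
  qed
  also have "\<dots> = (exp \<delta> - 1) * (\<Sum>k\<le>n. w k * E k)"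
    by (simp add: sum_distrib_left mult.left_commute)
  finally show ?thesis
    unfolding wE by (simp add: \<delta>_def m_def t_def)
qed

theorem mainTheorem18:
  fixes l0 l1 l2 a b M :: real
    and Lam :: "nat \<Rightarrow> complex list"
    and f :: "real \<Rightarrow> complex"
  assumes "l0 < l1" and "l2 \<noteq> l0" and "l2 \<noteq> l1" and "a < b"
    and "\<forall>n\<ge>2. length (Lam n) = n + 1 \<and> Lam n ! 0 = complex_of_real l0
            \<and> Lam n ! 1 = complex_of_real l1 \<and> Lam n ! 2 = complex_of_real l2"
    and "\<forall>n\<ge>2. \<forall>g\<in>Espace (Lam n). (\<lambda>x. cnj (g x)) \<in> Espace (Lam n)"
    and "M > 0" and "\<forall>n\<ge>2. \<forall>j\<le>n. \<bar>Im (Lam n ! j)\<bar> \<le> M"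
    and "b - a < pi / M"
    and "\<forall>\<epsilon>>0. \<exists>N. \<forall>n\<ge>N. \<forall>k\<in>{1..n}.
            \<bar>bnode (Lam n) a b k - bnode (Lam n) a b (k - 1)\<bar> < \<epsilon>"
    and "\<forall>\<epsilon>>0. \<exists>N. \<forall>n\<ge>N. \<forall>k<n.
            \<bar>ln (Re (Lim (at_left b) (\<lambda>x. bbasis (take 2 (Lam n) @ drop 3 (Lam n)) a b k x
                                         / bbasis (tl (Lam n)) a b k x)))
              / (bnode (Lam n) a b k - bnode (Lam n) a b (Suc k)) - (l2 - l0)\<bar> < \<epsilon>"
    and "continuous_on {a..b} f"
  shows "uniform_limit {a..b} (\<lambda>n. bop (Lam n) a b f) f sequentially"
proof -
  define fs where "fs = (\<lambda>n. drop 3 (Lam n))"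
  define W where "W = (\<lambda>n. bweight (Lam n) (tl (Lam n)) l0 a b)"
  define t where "t = (\<lambda>n. bnode (Lam n) a b)"
  have Lam: "Lam n = of_real l0 # of_real l1 # of_real l2 # fs n" if n: "n \<ge> 2" for n
  proof -
    have l: "length (Lam n) = n + 1" "Lam n ! 0 = of_real l0" "Lam n ! 1 = of_real l1"
        "Lam n ! 2 = of_real l2"
      using assms(5) n by auto
    have drop: "drop i (Lam n) = Lam n ! i # drop (Suc i) (Lam n)" if "i < 3" for i
      using Cons_nth_drop_Suc[of i "Lam n"] l(1) n that by simp
    have "Lam n = Lam n ! 0 # drop (Suc 0) (Lam n)"
      by (rule drop[of 0, unfolded drop_0]) simp
    also have "drop (Suc 0) (Lam n) = Lam n ! Suc 0 # drop (Suc (Suc 0)) (Lam n)"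
      by (rule drop) simp
    also have "drop (Suc (Suc 0)) (Lam n) = Lam n ! Suc (Suc 0) # drop (Suc (Suc (Suc 0))) (Lam n)"
      by (rule drop) simp
    also have "Lam n ! 0 # Lam n ! Suc 0 # Lam n ! Suc (Suc 0) # drop (Suc (Suc (Suc 0))) (Lam n)
        = of_real l0 # of_real l1 # of_real l2 # fs n"
      using l(2-4) by (simp add: fs_def numeral_2_eq_2 numeral_3_eq_3)
    finally show ?thesis .
  qed
  have adm: "admissible a b (Lam n)" if n: "n \<ge> 2" for n
  proof -
    have "\<bar>Im c\<bar> * (b - a) < pi" if c: "c \<in> set (Lam n)" for c
    proof -
      have "length (Lam n) = n + 1"
        using assms(5) n by blast
      then obtain j where "j \<le> n" "c = Lam n ! j"
        using c by (auto simp: in_set_conv_nth less_Suc_eq_le)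
      then have "\<bar>Im c\<bar> \<le> M"
        using assms(8) n by blast
      then have "\<bar>Im c\<bar> * (b - a) \<le> M * (b - a)"
        using assms(4) by (intro mult_right_mono) auto
      also have "\<dots> < pi"
        using assms(7,9) by (simp add: field_simps)
      finally show ?thesis .
    qed
    moreover have "image_mset cnj (mset (Lam n)) = mset (Lam n)"
      using assms(6) n by (intro cnj_closed_Espace_imp_mset) auto
    ultimately show ?thesis
      using assms(4) by (simp add: admissible_def)
  qed
  have len: "Suc (Suc (length (fs n))) = n" if "n \<ge> 2" for n
    using assms(5) that by (simp add: fs_def)
  have W_nonneg: "W n k x \<ge> 0" if "n \<ge> 2" "k \<le> n" "x \<in> {a..b}" for n k x
    using bweight_nonneg[OF adm[OF that(1), unfolded Lam[OF that(1)]] _ assms(1), of k x] that len[OF that(1)]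
    by (simp add: W_def Lam)
  have t_in: "t n k \<in> {a..b}" if "n \<ge> 2" "k \<le> n" for n k
    using bnode_in_interval[OF adm[OF that(1), unfolded Lam[OF that(1)]] _ assms(1), of k] that len[OF that(1)]
    by (simp add: t_def Lam)
  have sum0: "(\<Sum>k\<le>n. W n k x) = 1" if "n \<ge> 2" for n x
    using sum_bweight[OF adm[OF that, unfolded Lam[OF that]] _ assms(1), of x] len[OF that] that
    by (simp add: W_def Lam del: sum.atMost_Suc)
  have sum1: "(\<Sum>k\<le>n. W n k x * exp ((l1 - l0) * (t n k - x))) = 1" if "n \<ge> 2" for n x
    using sum_bweight_l1[OF adm[OF that, unfolded Lam[OF that]] _ assms(1), of x] len[OF that] that
    by (simp add: W_def t_def Lam del: sum.atMost_Suc)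
  have sum2: "\<exists>N. \<forall>n\<ge>N. \<forall>x\<in>{a..b}. \<bar>(\<Sum>k\<le>n. W n k x * exp ((l2 - l0) * (t n k - x))) - 1\<bar> \<le> \<eta>"
    if \<eta>: "\<eta> > 0" for \<eta>
  proof -
    \<comment> \<open>Chosen to make the bound exp(\<epsilon>(b - a)) - 1 equal to \<eta>.\<close>
    define \<epsilon> where "\<epsilon> = ln (1 + \<eta>) / (b - a)"
    have \<epsilon>: "\<epsilon> > 0" and exp_\<epsilon>: "exp (\<epsilon> * (b - a)) - 1 = \<eta>"
      using \<eta> assms(4) by (simp_all add: \<epsilon>_def)
    obtain N where N: "\<And>n k. n \<ge> N \<Longrightarrow> k < n \<Longrightarrow>
        \<bar>ln (Re (Lim (at_left b) (\<lambda>x. bbasis (take 2 (Lam n) @ drop 3 (Lam n)) a b k x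
            / bbasis (tl (Lam n)) a b k x))) / (t n k - t n (Suc k)) - (l2 - l0)\<bar> < \<epsilon>"
      using assms(11) \<epsilon> unfolding t_def by blast
    show ?thesis
    proof (intro exI[of _ "max N 2"] allI impI ballI)
      fix n x assume "n \<ge> max N 2" and x: "x \<in> {a..b}"
      then have n: "n \<ge> N" "n \<ge> 2" by auto
      define L0 L2 where "L0 = complex_of_real l1 # of_real l2 # fs n"
        and "L2 = complex_of_real l0 # of_real l1 # fs n"
      have tl: "tl (Lam n) = L0" and tk: "take 2 (Lam n) @ drop 3 (Lam n) = L2"
        using Lam[OF n(2)] by (simp_all add: L0_def L2_def)
      have admL: "admissible a b L0" "admissible a b L2"
        using admissible_drop_real[OF adm[OF n(2)], of l0 L0] admissible_drop_real[OF adm[OF n(2)], of l2 L2]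
          Lam[OF n(2)] by (simp_all add: L0_def L2_def)
      have "\<bar>ln (bend L2 a b k / bend L0 a b k) / (bnode (Lam n) a b k - bnode (Lam n) a b (Suc k))
          - (l2 - l0)\<bar> < \<epsilon>" if "k < n" for k
      proof -
        have "Lim (at_left b) (\<lambda>x. bbasis L2 a b k x / bbasis L0 a b k x)
            = of_real (bend L2 a b k / bend L0 a b k)"
          using that len[OF n(2)] by (intro Lim_bbasis_ratio admL) (simp_all add: L0_def L2_def)
        then show ?thesis
          using N[OF n(1) that] unfolding tl tk t_def by (simp only: Re_complex_of_real)
      qed
      then have "\<bar>(\<Sum>k\<le>n. bweight (Lam n) L0 l0 a b k x * exp ((l2 - l0) * (bnode (Lam n) a b k - x))) - 1\<bar>
          \<le> exp (\<epsilon> * (b - a)) - 1"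
        using sum_bweight_l2_bound[OF adm[OF n(2), unfolded Lam[OF n(2)]] assms(1) \<epsilon> x]
        unfolding L0_def L2_def Lam[OF n(2), symmetric] len[OF n(2)] by blast
      then show "\<bar>(\<Sum>k\<le>n. W n k x * exp ((l2 - l0) * (t n k - x))) - 1\<bar> \<le> \<eta>"
        unfolding exp_\<epsilon> W_def t_def tl .
    qed
  qed
  define h where "h = (\<lambda>y. of_real (exp (- l0 * y)) * f y)"
  have h: "continuous_on {a..b} h"
    unfolding h_def by (intro continuous_intros assms(12))
  \<comment> \<open>Bounds the exponential on the interval whichever sign \<open>l0\<close> has, its
    maximum being at an endpoint.\<close>
  define K where "K = exp (l0 * a) + exp (l0 * b)"
  have K: "K > 0"
    by (simp add: K_def add_pos_pos)
  have exp_le_K: "exp (l0 * x) \<le> K" if "x \<in> {a..b}" for x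
  proof -
    have "l0 * x \<le> l0 * a \<or> l0 * x \<le> l0 * b"
      using that by (cases "l0 \<ge> 0") (auto intro: mult_left_mono mult_left_mono_neg)
    then have "exp (l0 * x) \<le> exp (l0 * a) \<or> exp (l0 * x) \<le> exp (l0 * b)"
      by simp
    then show ?thesis
      unfolding K_def using exp_gt_zero[of "l0 * a"] exp_gt_zero[of "l0 * b"] by linarith
  qed
  show ?thesis
    unfolding uniform_limit_iff eventually_sequentially
  proof (intro allI impI)
    fix \<epsilon> :: real assume "\<epsilon> > 0"
    then have "\<epsilon> / K > 0"
      using K by simp
    have "\<exists>N. \<forall>n\<ge>N. \<forall>x\<in>{a..b}. norm ((\<Sum>k\<le>n. of_real (W n k x) * h (t n k)) - h x) < \<epsilon> / K"
      by (rule korovkin_exponential[where ?m1.0 = "l1 - l0" and ?m2.0 = "l2 - l0" and ?n0.0 = 2,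
            OF assms(4) _ _ _ h W_nonneg t_in sum0 sum1 sum2 \<open>\<epsilon> / K > 0\<close>])
        (use assms(1-3) in auto)
    then obtain N where N: "\<And>n x. n \<ge> N \<Longrightarrow> x \<in> {a..b} \<Longrightarrow>
        norm ((\<Sum>k\<le>n. of_real (W n k x) * h (t n k)) - h x) < \<epsilon> / K"
      by blast
    show "\<exists>N. \<forall>n\<ge>N. \<forall>x\<in>{a..b}. dist (bop (Lam n) a b f x) (f x) < \<epsilon>"
    proof (intro exI[of _ "max N 2"] allI impI ballI)
      fix n x assume "n \<ge> max N 2" and x: "x \<in> {a..b}"
      then have n: "n \<ge> N" "n \<ge> 2" by auto
      define S where "S = (\<Sum>k\<le>n. of_real (W n k x) * h (t n k))"
      have "bop (Lam n) a b f x = of_real (exp (l0 * x)) * S"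
        using bop_eq_bweight[OF adm[OF n(2), unfolded Lam[OF n(2)]] _ assms(1), of f x] len[OF n(2)] n(2)
        by (simp add: S_def h_def W_def t_def Lam del: sum.atMost_Suc)
      moreover have "f x = of_real (exp (l0 * x)) * h x"
      proof -
        have "exp (l0 * x) * exp (- l0 * x) = 1"
          by (simp add: exp_add[symmetric])
        then have "complex_of_real (exp (l0 * x)) * of_real (exp (- l0 * x)) = 1"
          by (metis of_real_1 of_real_mult)
        then show ?thesis
          unfolding h_def mult.assoc[symmetric] by simp
      qed
      ultimately have "dist (bop (Lam n) a b f x) (f x) = exp (l0 * x) * norm (S - h x)"
        by (simp add: dist_norm right_diff_distrib[symmetric] norm_mult del: of_real_exp)
      also have "\<dots> \<le> K * norm (S - h x)"
        by (intro mult_right_mono exp_le_K x) simp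
      also have "\<dots> < K * (\<epsilon> / K)"
        using N[OF n(1) x] K unfolding S_def by (intro mult_strict_left_mono)
      also have "\<dots> = \<epsilon>"
        using K by simp
      finally show "dist (bop (Lam n) a b f x) (f x) < \<epsilon>" .
    qed
  qed
qed

end
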